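(* Let $X\in\mathbb R^{n\times q}$ be a known matrix of rank $q<n$, and let $\mathcal G$ be the group of transformations on $\mathbb R^{n\times p}$ of the form $g(Y)=XC^T+YA^T$ with $C\in\mathbb R^{p\times q}$ and nonsingular $A\in\mathbb R^{p\times p}$. Let $\phi$ be a level-$\alpha$ $\mathcal G$-invariant test of $H:\Psi=I_n$ versus $K:\Psi\ne I_n$ in the model $Y\sim N_{n\times p}(XB^T,\Sigma\otimes\Psi)$, where $B\in\mathbb R^{p\times q}$, $\Sigma\in\mathcal S_p^+$, $\Psi\in\mathcal S_n^+$. If $\mathrm E[\phi(Y)\mid B,\Sigma\otimes\Psi]\ge\alpha$ for all $\Psi\in\mathcal S_n^+$, then $\mathrm E[\phi(Y)\mid B,\Sigma\otimes\Psi]=\alpha$ for all $\Psi\in\mathcal S_n^+$.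
   Context: $\mathcal S_k^+$ is the set of $k\times k$ symmetric positive definite matrices. $Y\sim N_{n\times p}(M,\Sigma\otimes\Psi)$ means $Y$ has the distribution of $M+\Psi^{1/2}Z\Sigma^{1/2}$, where $Z$ is an $n\times p$ matrix of i.i.d. standard normal entries and square roots are symmetric. $\mathrm E[\,\cdot\mid B,\Sigma\otimes\Psi]$ is expectation under $Y\sim N_{n\times p}(XB^T,\Sigma\otimes\Psi)$. A test is a measurable function $\phi:\mathbb R^{n\times p}\to[0,1]$; it is $\mathcal G$-invariant if $\phi(g(Y))=\phi(Y)$ for all $g\in\mathcal G$ and all $Y$. The expectation of a $\mathcal G$-invariant test under $H$ does not depend on $B$ or $\Sigma$, and such a test is called level-$\alpha$ if $\mathrm E[\phi(Y)\mid B,\Sigma\otimes I_n]=\alpha$. *)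

theory Defs
  imports "HOL-Probability.Probability"
begin

definition sym_pos_def :: "(real ^ 'k ^ 'k) set" where
  "sym_pos_def = {A. transpose A = A \<and> (\<forall>x. x \<noteq> 0 \<longrightarrow> 0 < x \<bullet> (A *v x))}"

(* Used on sym_pos_def only, where a square root in sym_pos_def exists and is unique. *)
definition sym_sqrt :: "real ^ 'k ^ 'k \<Rightarrow> real ^ 'k ^ 'k" where
  "sym_sqrt A = (THE R. R \<in> sym_pos_def \<and> R ** R = A)"

(* The law of an n x p matrix of i.i.d. standard normal entries. *)
definition std_matrix_normal :: "(real ^ 'p ^ 'n) measure" where
  "std_matrix_normal =
     distr (\<Pi>\<^sub>M ij \<in> (UNIV :: ('n \<times> 'p) set). density lborel (\<lambda>x. ennreal (std_normal_density x)))
           borel (\<lambda>z. \<chi> i j. z (i, j))"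

(* N(M, Sigma (x) Psi): each row has covariance proportional to Sigma, each column to Psi. *)
definition matrix_normal ::
    "real ^ 'p ^ 'n \<Rightarrow> real ^ 'p ^ 'p \<Rightarrow> real ^ 'n ^ 'n \<Rightarrow> (real ^ 'p ^ 'n) measure" where
  "matrix_normal M \<Sigma> \<Psi> =
     distr std_matrix_normal borel (\<lambda>Z. M + sym_sqrt \<Psi> ** Z ** sym_sqrt \<Sigma>)"

definition model_expectation ::
    "real ^ 'q ^ 'n \<Rightarrow> real ^ 'q ^ 'p \<Rightarrow> real ^ 'p ^ 'p \<Rightarrow> real ^ 'n ^ 'n
      \<Rightarrow> (real ^ 'p ^ 'n \<Rightarrow> real) \<Rightarrow> real" where
  "model_expectation X B \<Sigma> \<Psi> f =
     (\<integral>Y. f Y \<partial>matrix_normal (X ** transpose B) \<Sigma> \<Psi>)"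

definition is_test :: "(real ^ 'p ^ 'n \<Rightarrow> real) \<Rightarrow> bool" where
  "is_test \<phi> \<longleftrightarrow> \<phi> \<in> borel_measurable borel \<and> (\<forall>Y. 0 \<le> \<phi> Y \<and> \<phi> Y \<le> 1)"

definition transf_group :: "real ^ 'q ^ 'n \<Rightarrow> (real ^ 'p ^ 'n \<Rightarrow> real ^ 'p ^ 'n) set" where
  "transf_group X =
     {g. \<exists>(C :: real ^ 'q ^ 'p) (A :: real ^ 'p ^ 'p).
           invertible A \<and> g = (\<lambda>Y. X ** transpose C + Y ** transpose A)}"

definition invariant_test ::
    "(real ^ 'p ^ 'n \<Rightarrow> real ^ 'p ^ 'n) set \<Rightarrow> (real ^ 'p ^ 'n \<Rightarrow> real) \<Rightarrow> bool" where
  "invariant_test G \<phi> \<longleftrightarrow> (\<forall>g\<in>G. \<forall>Y. \<phi> (g Y) = \<phi> Y)"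

definition level_test :: "real ^ 'q ^ 'n \<Rightarrow> real \<Rightarrow> (real ^ 'p ^ 'n \<Rightarrow> real) \<Rightarrow> bool" where
  "level_test X \<alpha> \<phi> \<longleftrightarrow>
     (\<forall>(B :: real ^ 'q ^ 'p). \<forall>\<Sigma>\<in>sym_pos_def. model_expectation X B \<Sigma> (mat 1) \<phi> = \<alpha>)"

end

theory Submission
  imports Defs
begin

text \<open>By invariance the power at \<open>\<Psi>\<close> is \<open>\<beta> S = E \<phi> (S Z)\<close> with \<open>Z\<close> standard normal and \<open>S S\<^sup>T = \<Psi>\<close>.
  If \<open>p \<ge> n\<close>, almost every \<open>Z\<close> has full row rank, and \<open>S Z\<close> is then a column
  transformation of \<open>Z\<close>, so \<open>\<phi>\<close> is almost surely constant. If \<open>p \<le> n\<close>, take \<open>S = G\<close> random, an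
  \<open>n \<times> n\<close> standard normal matrix independent of \<open>Z\<close>. Given \<open>Z\<close>, the matrix \<open>G Z\<close> follows the null
  model with column covariance \<open>Z\<^sup>T Z\<close>, so the expectation of \<open>\<phi> (G Z)\<close> is \<open>\<alpha>\<close>. Given \<open>G\<close>, it is
  \<open>\<beta> G \<ge> \<alpha>\<close>. Therefore \<open>\<beta> G = \<alpha>\<close> for almost every \<open>G\<close>, and by continuity for every
  invertible \<open>G\<close>.\<close>

section \<open>Symmetric positive definite matrices and their square roots\<close>

text \<open>The quadratic form \<open>x \<bullet> f x\<close> attains its maximum \<open>M\<close>
  on the compact unit sphere of \<open>S\<close>. At a maximiser \<open>v\<close> the first
  variation in the direction \<open>z = f v - M v\<close> must vanish, and it equals
  \<open>2 * (z \<bullet> z)\<close>.\<close>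

lemma selfadjoint_eigenvector:
  fixes f :: "'a::euclidean_space \<Rightarrow> 'a"
  assumes f: "linear f" and sa: "\<And>x y. f x \<bullet> y = x \<bullet> f y"
    and S: "subspace S" "f ` S \<subseteq> S" "S \<noteq> {0}"
  obtains v c where "v \<in> S" "norm v = 1" "f v = c *\<^sub>R v"
proof -
  let ?K = "S \<inter> sphere 0 1"
  obtain u where u: "u \<in> S" "u \<noteq> 0"
    using S subspace_0 by blast
  have "u /\<^sub>R norm u \<in> ?K"
    using u S(1) by (simp add: subspace_scale)
  hence "?K \<noteq> {}" by blast
  moreover have "compact ?K"
    using closed_subspace[OF S(1)] by (simp add: closed_Int_compact)
  moreover have "continuous_on ?K (\<lambda>x. x \<bullet> f x)"
    by (intro continuous_intros linear_continuous_on linear_conv_bounded_linear[THEN iffD1] f)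
  ultimately obtain v where v: "v \<in> ?K" "\<And>y. y \<in> ?K \<Longrightarrow> y \<bullet> f y \<le> v \<bullet> f v"
    using continuous_attains_sup[of ?K] by blast
  define M where "M = v \<bullet> f v"
  have vv: "v \<bullet> v = 1" "v \<in> S" "norm v = 1"
    using v(1) by (auto simp: dot_square_norm)
  have max: "x \<bullet> f x \<le> M * (x \<bullet> x)" if "x \<in> S" for x
  proof (cases "x = 0")
    case False
    have "x /\<^sub>R norm x \<in> ?K"
      using that False S(1) by (simp add: subspace_scale)
    hence "(x /\<^sub>R norm x) \<bullet> f (x /\<^sub>R norm x) \<le> M"
      using v(2) M_def by blast
    hence "(x \<bullet> f x) / (norm x)\<^sup>2 \<le> M"
      using f by (simp add: linear_scale power2_eq_square divide_inverse mult_ac)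
    thus ?thesis
      using False by (simp add: divide_le_eq dot_square_norm)
  qed (use f in \<open>simp add: linear_0\<close>)
  define z where "z = f v - M *\<^sub>R v"
  have zS: "z \<in> S"
    unfolding z_def using S vv by (intro subspace_diff subspace_scale) auto
  have zv: "v \<bullet> z = 0"
    unfolding z_def by (simp add: inner_diff_right vv M_def)
  have a: "z \<bullet> f v = z \<bullet> z"
    using zv by (simp add: z_def inner_diff_right inner_diff_left inner_commute)
  have a': "v \<bullet> f z = z \<bullet> z"
    using sa[of v z] a by (simp add: inner_commute)
  define k where "k = M * (z \<bullet> z) - z \<bullet> f z"
  \<comment> \<open>This is maximality at \<open>v + t z\<close>, with the terms of order 0
    cancelled. A term linear in \<open>t\<close> stays below a quadratic one for every
    \<open>t\<close> only if its coefficient is 0.\<close>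
  have quad: "2 * t * (z \<bullet> z) \<le> t\<^sup>2 * k" for t
  proof -
    have "(v + t *\<^sub>R z) \<bullet> f (v + t *\<^sub>R z) \<le> M * ((v + t *\<^sub>R z) \<bullet> (v + t *\<^sub>R z))"
      using max vv zS S(1) by (simp add: subspace_add subspace_scale)
    moreover have "(v + t *\<^sub>R z) \<bullet> f (v + t *\<^sub>R z) = M + 2 * t * (z \<bullet> z) + t\<^sup>2 * (z \<bullet> f z)"
      using f a a' by (simp add: linear_add linear_scale inner_add_left inner_add_right M_def power2_eq_square algebra_simps)
    moreover have "(v + t *\<^sub>R z) \<bullet> (v + t *\<^sub>R z) = 1 + t\<^sup>2 * (z \<bullet> z)"
      using zv vv by (simp add: inner_add_left inner_add_right power2_eq_square inner_commute algebra_simps)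
    ultimately have "M + 2 * t * (z \<bullet> z) + t\<^sup>2 * (z \<bullet> f z) \<le> M * (1 + t\<^sup>2 * (z \<bullet> z))"
      by simp
    thus ?thesis
      by (simp add: k_def algebra_simps)
  qed
  have "z \<bullet> z = 0"
  proof (rule ccontr)
    assume nz: "z \<bullet> z \<noteq> 0"
    hence pos: "z \<bullet> z > 0" by (metis inner_ge_zero less_eq_real_def)
    \<comment> \<open>Any positive \<open>m\<close> above \<open>k\<close> will do:
      \<open>t = (z \<bullet> z) / m\<close> turns \<open>quad\<close> into
      \<open>2 * m \<le> k\<close>.\<close>
    define m where "m = \<bar>k\<bar> + 1"
    have m: "m > 0" "k < m" by (auto simp: m_def)
    have "2 * ((z \<bullet> z) / m) * (z \<bullet> z) \<le> ((z \<bullet> z) / m)\<^sup>2 * k"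
      by (rule quad)
    hence "2 * (z \<bullet> z)\<^sup>2 * m \<le> (z \<bullet> z)\<^sup>2 * k"
      using m by (simp add: field_simps power2_eq_square)
    hence "2 * m \<le> k" using pos by simp
    thus False using m by linarith
  qed
  hence "f v = M *\<^sub>R v" by (simp add: z_def)
  thus thesis using that vv by blast
qed

text \<open>Orthonormal eigenvectors are added one at a time. Self-adjointness makes the orthogonal
  complement of those already found invariant under \<open>f\<close>, so it contains a further
  eigenvector as long as it is nonzero.\<close>

lemma selfadjoint_eigenbasis:
  fixes f :: "'a::euclidean_space \<Rightarrow> 'a"
  assumes f: "linear f" and sa: "\<And>x y. f x \<bullet> y = x \<bullet> f y"
  obtains B c where "finite B" "pairwise orthogonal B" "\<And>b. b \<in> B \<Longrightarrow> norm b = 1"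
    "\<And>b. b \<in> B \<Longrightarrow> f b = c b *\<^sub>R b" "span B = UNIV"
proof -
  have "\<exists>B c. finite B \<and> card B = k \<and> pairwise orthogonal B
      \<and> (\<forall>b\<in>B. norm b = 1 \<and> f b = c b *\<^sub>R b)" if "k \<le> DIM('a)" for k
    using that
  proof (induction k)
    case 0
    show ?case by (intro exI[of _ "{}"]) auto
  next
    case (Suc k)
    then obtain B c where B: "finite B" "card B = k" "pairwise orthogonal B"
      "\<forall>b\<in>B. norm b = 1 \<and> f b = c b *\<^sub>R b" by (meson Suc_leD)
    let ?S = "{x. \<forall>b\<in>B. b \<bullet> x = 0}"
    have "dim B < DIM('a)"
      using B Suc.prems dim_le_card'[of B] by simp
    then obtain u where "u \<noteq> 0" "\<And>y. y \<in> span B \<Longrightarrow> orthogonal u y"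
      using orthogonal_to_subspace_exists[of B] by blast
    hence "u \<in> ?S" "u \<noteq> 0"
      by (auto simp: orthogonal_def inner_commute span_base)
    hence "?S \<noteq> {0}" by blast
    moreover have "subspace ?S"
      by (auto simp: subspace_def inner_add_right)
    moreover have "f ` ?S \<subseteq> ?S"
      using B(4) by (auto simp: sa[symmetric])
    ultimately obtain v d where v: "v \<in> ?S" "norm v = 1" "f v = d *\<^sub>R v"
      using selfadjoint_eigenvector[OF f sa] by blast
    have "v \<notin> B" using v by (auto simp: dot_square_norm dest: bspec[of B _ v])
    moreover have "pairwise orthogonal (insert v B)"
      using B(3) v(1) by (auto simp: pairwise_insert orthogonal_def inner_commute)
    ultimately show ?case
      using B v by (intro exI[of _ "insert v B"] exI[of _ "c(v := d)"]) auto
  qed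
  then obtain B c where B: "finite B" "card B = DIM('a)" "pairwise orthogonal B"
      "\<forall>b\<in>B. norm b = 1 \<and> f b = c b *\<^sub>R b" by blast
  have "independent B"
    using B by (intro pairwise_orthogonal_independent) auto
  hence "span B = UNIV"
    using B by (metis card_eq_dim dim_UNIV order_refl subset_UNIV top.extremum_uniqueI)
  thus thesis using that B by blast
qed

lemma symmetric_matrix_eigenbasis:
  fixes A :: "real^'k^'k"
  assumes "transpose A = A"
  obtains B c where "finite B" "pairwise orthogonal B" "\<And>b. b \<in> B \<Longrightarrow> norm b = 1"
    "\<And>b. b \<in> B \<Longrightarrow> A *v b = c b *\<^sub>R b" "span B = UNIV"
proof -
  have "(A *v x) \<bullet> y = x \<bullet> (A *v y)" for x y
    using assms by (metis dot_lmul_matrix transpose_matrix_vector)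
  then obtain B c where "finite B" "pairwise orthogonal B" "\<And>b. b \<in> B \<Longrightarrow> norm b = 1"
    "\<And>b. b \<in> B \<Longrightarrow> A *v b = c b *\<^sub>R b" "span B = UNIV"
    using selfadjoint_eigenbasis[OF matrix_vector_mul_linear[of A]] by metis
  thus thesis by (rule that)
qed

lemma matrix_eq_on_spanning:
  fixes A A' :: "real^'k^'m"
  assumes "span B = UNIV" "\<And>b. b \<in> B \<Longrightarrow> A *v b = A' *v b"
  shows "A = A'"
proof -
  have "A *v x = A' *v x" for x
    using linear_eq_on_span[of "(*v) A" "(*v) A'" B x] assms by auto
  thus ?thesis by (simp add: matrix_eq)
qed

lemma invertible_sym_pos_def:
  assumes "A \<in> sym_pos_def" shows "invertible A"
proof -
  have "x = 0" if "A *v x = 0" for x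
    using assms that by (auto simp: sym_pos_def_def)
  thus ?thesis
    by (auto simp: invertible_left_inverse matrix_left_invertible_ker)
qed

lemma mat_1_sym_pos_def: "mat 1 \<in> sym_pos_def"
  by (simp add: sym_pos_def_def)

lemma gram_sym_pos_def:
  fixes G :: "real^'k^'k"
  assumes "invertible G" shows "G ** transpose G \<in> sym_pos_def"
proof -
  have "0 < x \<bullet> ((G ** transpose G) *v x)" if "x \<noteq> 0" for x
  proof -
    have "x \<bullet> ((G ** transpose G) *v x) = (transpose G *v x) \<bullet> (transpose G *v x)"
      by (metis dot_lmul_matrix matrix_vector_mul_assoc transpose_matrix_vector)
    moreover have "transpose G *v x \<noteq> 0"
      using assms that transpose_invertible[OF assms]
      by (metis invertible_left_inverse matrix_left_invertible_ker)
    ultimately show ?thesis by simp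
  qed
  thus ?thesis by (simp add: sym_pos_def_def matrix_transpose_mul)
qed

text \<open>In an orthonormal eigenbasis the eigenvalues are positive, and the root multiplies each
  coordinate by the square root of its eigenvalue.\<close>

lemma sym_pos_def_sqrt_exists:
  fixes A :: "real^'k^'k"
  assumes A: "A \<in> sym_pos_def"
  shows "\<exists>R\<in>sym_pos_def. R ** R = A"
proof -
  have sym: "transpose A = A" using A by (simp add: sym_pos_def_def)
  obtain B c where B: "finite B" "pairwise orthogonal B" "\<And>b. b \<in> B \<Longrightarrow> norm b = 1"
    "\<And>b. b \<in> B \<Longrightarrow> A *v b = c b *\<^sub>R b" "span B = UNIV"
    using symmetric_matrix_eigenbasis[OF sym] by blast
  have cpos: "c b > 0" if "b \<in> B" for b
  proof -
    have "b \<noteq> 0" using B(3)[OF that] by auto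
    hence "0 < b \<bullet> (A *v b)" using A by (auto simp: sym_pos_def_def)
    thus ?thesis using B(3,4)[OF that] by (simp add: dot_square_norm)
  qed
  define g where "g x = (\<Sum>b\<in>B. (sqrt (c b) * (b \<bullet> x)) *\<^sub>R b)" for x
  have g: "linear g"
    unfolding g_def
    by (rule linearI)
      (simp_all add: inner_add_right algebra_simps scaleR_left.add sum.distrib scaleR_sum_right)
  define R where "R = matrix g"
  have R: "R *v x = g x" for x
    unfolding R_def using g by (simp add: matrix_works)
  have inner_g: "y \<bullet> g x = (\<Sum>b\<in>B. sqrt (c b) * (b \<bullet> x) * (b \<bullet> y))" for x y
    by (simp add: g_def inner_sum_right inner_commute)
  have gb: "g b = sqrt (c b) *\<^sub>R b" if "b \<in> B" for b
  proof -
    have "b' \<bullet> b = (if b' = b then 1 else 0)" if "b' \<in> B" for b'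
      using B(2,3) \<open>b \<in> B\<close> that by (auto simp: pairwise_def orthogonal_def dot_square_norm)
    hence "g b = (\<Sum>b'\<in>B. if b' = b then sqrt (c b) *\<^sub>R b else 0)"
      unfolding g_def by (intro sum.cong) auto
    thus ?thesis using that B(1) by simp
  qed
  have "transpose R = R"
  proof -
    have "(R *v x) \<bullet> y = x \<bullet> (R *v y)" for x y
      using inner_g[of x y] inner_g[of y x] by (simp add: R inner_commute mult_ac)
    hence "(transpose R *v x) \<bullet> y = (R *v x) \<bullet> y" for x y
      by (metis dot_lmul_matrix transpose_matrix_vector)
    hence "transpose R *v x = R *v x" for x
      by (metis vector_eq_ldot inner_commute)
    thus ?thesis by (simp add: matrix_eq)
  qed
  moreover have "0 < x \<bullet> (R *v x)" if "x \<noteq> 0" for x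
  proof -
    \<comment> \<open>By \<open>inner_g\<close>, the form is a sum of the nonnegative terms
      \<open>sqrt (c b) * (b \<bullet> x)^2\<close>, so one nonzero coordinate makes it
      positive.\<close>
    have "\<exists>b\<in>B. b \<bullet> x \<noteq> 0"
    proof (rule ccontr)
      assume "\<not> ?thesis"
      hence "orthogonal x b" if "b \<in> B" for b using that by (auto simp: orthogonal_def inner_commute)
      hence "orthogonal x x" using orthogonal_to_span[of x B x] B(5) by auto
      thus False using that by (simp add: orthogonal_def)
    qed
    then obtain b where "b \<in> B" "b \<bullet> x \<noteq> 0" by blast
    thus ?thesis
      using B(1) cpos unfolding R inner_g
      by (intro sum_pos2[of B b]) (auto simp: mult.assoc less_imp_le zero_less_mult_iff not_less_iff_gr_or_eq less_le)
  qed
  moreover have "R ** R = A"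
  proof (rule matrix_eq_on_spanning[OF B(5)])
    fix b assume b: "b \<in> B"
    show "(R ** R) *v b = A *v b"
      using gb[OF b] g cpos[OF b] B(4)[OF b]
      by (simp add: R linear_scale flip: matrix_vector_mul_assoc)
  qed
  ultimately show ?thesis by (auto simp: sym_pos_def_def)
qed

text \<open>An eigenvector \<open>x\<close> of \<open>D = R - S\<close> with eigenvalue \<open>c\<close> gives
  \<open>0 = x \<bullet> (R D + D S) x = c * (x \<bullet> (R + S) x)\<close>.\<close>

lemma sym_pos_def_sqrt_unique:
  fixes R S :: "real^'k^'k"
  assumes R: "R \<in> sym_pos_def" and S: "S \<in> sym_pos_def" and eq: "R ** R = S ** S"
  shows "R = S"
proof -
  define D where "D = R - S"
  have sym: "transpose R = R" "transpose S = S"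
    using R S by (auto simp: sym_pos_def_def)
  hence D: "transpose D = D"
    by (simp add: D_def transpose_def vec_eq_iff)
  obtain B c where B: "finite B" "pairwise orthogonal B" "\<And>b. b \<in> B \<Longrightarrow> norm b = 1"
    "\<And>b. b \<in> B \<Longrightarrow> D *v b = c b *\<^sub>R b" "span B = UNIV"
    using symmetric_matrix_eigenbasis[OF D] by blast
  have "R *v b = S *v b" if b: "b \<in> B" for b
  proof -
    have eqb: "R *v b - S *v b = c b *\<^sub>R b"
      using B(4)[OF b] by (simp add: D_def matrix_vector_mult_diff_rdistrib)
    have nz: "b \<noteq> 0" using B(3)[OF b] by auto
    have adj: "x \<bullet> (R *v y) = (R *v x) \<bullet> y" "x \<bullet> (S *v y) = (S *v x) \<bullet> y" for x y
      by (metis sym dot_lmul_matrix transpose_matrix_vector)+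
    have "b \<bullet> (R *v (R *v b)) = b \<bullet> (S *v (S *v b))"
      using eq by (simp add: matrix_vector_mul_assoc)
    hence "0 = (R *v b - S *v b) \<bullet> (R *v b + S *v b)"
      using adj[of b "R *v b"] adj[of b "S *v b"]
      by (simp add: inner_diff_left inner_diff_right inner_add_right inner_commute)
    also have "\<dots> = c b * (b \<bullet> (R *v b) + b \<bullet> (S *v b))"
      by (simp add: eqb inner_add_right distrib_left)
    finally have "c b * (b \<bullet> (R *v b) + b \<bullet> (S *v b)) = 0" by simp
    moreover have "b \<bullet> (R *v b) > 0" "b \<bullet> (S *v b) > 0"
      using R S nz by (auto simp: sym_pos_def_def)
    ultimately have "c b = 0" by auto
    thus ?thesis using eqb by simp
  qed
  thus ?thesis by (rule matrix_eq_on_spanning[OF B(5)])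
qed

lemma sym_sqrt_unique:
  assumes "R \<in> sym_pos_def" "R ** R = A"
  shows "sym_sqrt A = R"
  unfolding sym_sqrt_def using assms sym_pos_def_sqrt_unique by blast

lemma
  assumes "A \<in> sym_pos_def"
  shows sym_sqrt_sym_pos_def: "sym_sqrt A \<in> sym_pos_def"
    and sym_sqrt_square: "sym_sqrt A ** sym_sqrt A = A"
  using sym_pos_def_sqrt_exists[OF assms] sym_sqrt_unique[of _ A] by metis+

lemma sym_sqrt_mat_1: "sym_sqrt (mat 1) = mat 1"
  by (rule sym_sqrt_unique) (simp_all add: mat_1_sym_pos_def)

section \<open>Orthogonal factors and matrix inverses\<close>

text \<open>The ranges of \<open>J\<close> and \<open>Z\<close> have equal dimension, and so do
  their orthogonal complements. Isometries between ranges and between complements glue to an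
  orthogonal \<open>Q\<close> carrying range \<open>J\<close> onto range \<open>Z\<close>; what
  remains is a change of basis \<open>A\<close>.\<close>

lemma matrix_factor_orthogonal:
  fixes Z J :: "real^'p^'n"
  assumes Z: "\<And>x. Z *v x = 0 \<Longrightarrow> x = 0" and J: "transpose J ** J = mat 1"
  obtains Q A where "orthogonal_matrix Q" "invertible A" "Z = Q ** J ** A"
proof -
  note transpose_matrix_vector [simp del]
  define S where "S = range ((*v) J)"
  define T where "T = range ((*v) Z)"
  define S' where "S' = {y. \<forall>x\<in>S. orthogonal x y}"
  define T' where "T' = {y. \<forall>x\<in>T. orthogonal x y}"
  \<comment> \<open>As \<open>J\<close> has orthonormal columns, this is the orthogonal projection
    onto \<open>S\<close>.\<close>
  define P where "P x = (J ** transpose J) *v x" for x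
  have JJ: "transpose J *v (J *v x) = x" for x
    using J by (simp add: matrix_vector_mul_assoc)
  have sub: "subspace S" "subspace T" "subspace S'" "subspace T'"
    unfolding S'_def T'_def
    by (auto simp: S_def T_def intro: linear_subspace_image)
      (auto simp: subspace_def orthogonal_clauses)
  have "inj ((*v) J)" by (metis JJ injI)
  moreover have "inj ((*v) Z)"
    using Z by (simp add: linear_injective_0)
  ultimately have dST: "dim S = dim T"
    unfolding S_def T_def by (simp add: dim_image_eq)
  moreover have "dim S' + dim S = CARD('n)" "dim T' + dim T = CARD('n)"
    using dim_subspace_orthogonal_to_vectors[OF sub(1) subspace_UNIV]
      dim_subspace_orthogonal_to_vectors[OF sub(2) subspace_UNIV]
    by (simp_all add: S'_def T'_def)
  ultimately have dST': "dim S' = dim T'" by simp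
  obtain f where f: "linear f" "f ` S = T" "\<And>x. x \<in> S \<Longrightarrow> norm (f x) = norm x"
    using isometries_subspaces[OF sub(1,2) dST] by metis
  obtain f' where f': "linear f'" "f' ` S' = T'" "\<And>x. x \<in> S' \<Longrightarrow> norm (f' x) = norm x"
    using isometries_subspaces[OF sub(3,4) dST'] by metis
  define g where "g x = f (P x) + f' (x - P x)" for x
  have linP: "linear P"
    unfolding P_def by (rule matrix_vector_mul_linear)
  have ling: "linear g"
    by (rule linearI)
      (simp_all add: g_def linear_add[OF f(1)] linear_add[OF linP] linear_add[OF f'(1)] add_diff_add
        linear_scale[OF f(1)] linear_scale[OF linP] linear_scale[OF f'(1)] scaleR_add_right
        flip: scaleR_diff_right)
  have PS: "P x \<in> S" for x by (auto simp: P_def S_def simp flip: matrix_vector_mul_assoc)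
  have PS': "x - P x \<in> S'" for x
  proof -
    have "transpose J *v (x - P x) = 0"
      by (simp add: P_def JJ matrix_vector_mult_diff_distrib flip: matrix_vector_mul_assoc)
    hence "(J *v y) \<bullet> (x - P x) = 0" for y
      by (metis dot_lmul_matrix inner_commute inner_zero_left vector_transpose_matrix)
    thus ?thesis by (auto simp: S'_def S_def orthogonal_def)
  qed
  have Pid: "P s = s" if "s \<in> S" for s
    using that by (auto simp: S_def P_def JJ simp flip: matrix_vector_mul_assoc)
  have pyth: "norm (a + b) ^ 2 = norm a ^ 2 + norm b ^ 2" if "orthogonal a b" for a b :: "real^'n"
    using that norm_add_Pythagorean by blast
  have "norm (g x) = norm x" for x
  proof -
    have "orthogonal (f (P x)) (f' (x - P x))"
      using f(2) f'(2) PS PS' by (auto simp: T'_def)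
    hence "norm (g x) ^ 2 = norm (P x) ^ 2 + norm (x - P x) ^ 2"
      by (simp add: g_def pyth f(3) f'(3) PS PS')
    also have "\<dots> = norm (P x + (x - P x)) ^ 2"
      using PS PS' by (intro pyth[symmetric]) (auto simp: S'_def)
    finally show ?thesis by simp
  qed
  hence "orthogonal_transformation g"
    using ling by (simp add: orthogonal_transformation)
  define Q where "Q = matrix g"
  have Q: "orthogonal_matrix Q"
    using \<open>orthogonal_transformation g\<close> unfolding Q_def orthogonal_transformation_matrix by blast
  have Qv: "Q *v x = g x" for x
    unfolding Q_def using ling by (simp add: matrix_works)
  \<comment> \<open>Forced by \<open>Z = Q ** J ** A\<close>: multiply on the left by
    \<open>transpose Q\<close>, then by \<open>transpose J\<close>.\<close>
  define A where "A = transpose J ** transpose Q ** Z"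
  have eq: "(Q ** J ** A) *v y = Z *v y" for y
  proof -
    have "Z *v y \<in> T" by (auto simp: T_def)
    then obtain s where s: "s \<in> S" "Z *v y = f s" using f(2) by blast
    hence "Z *v y = Q *v s" using Pid f'(1) by (simp add: Qv g_def linear_0)
    moreover have "transpose Q *v (Q *v s) = s"
      using Q by (simp add: matrix_vector_mul_assoc orthogonal_matrix_def)
    ultimately show ?thesis
      using Pid[OF s(1)] by (simp add: A_def P_def flip: matrix_vector_mul_assoc)
  qed
  hence "Z = Q ** J ** A" by (simp add: matrix_eq)
  moreover have "invertible A"
    unfolding invertible_left_inverse matrix_left_invertible_ker
  proof (intro allI impI)
    fix x assume "A *v x = 0"
    hence "Z *v x = 0" using eq[of x] by (simp flip: matrix_vector_mul_assoc)
    thus "x = 0" by (rule Z)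
  qed
  ultimately show thesis using that Q by blast
qed

section \<open>Continuity of matrix inversion by Cramer's rule\<close>

lemma matrix_inv_inverse:
  fixes A :: "'a::semiring_1^'n^'m"
  assumes "invertible A"
  shows "A ** matrix_inv A = mat 1" "matrix_inv A ** A = mat 1"
proof -
  have "A ** matrix_inv A = mat 1 \<and> matrix_inv A ** A = mat 1"
    using assms unfolding invertible_def matrix_inv_def by (rule someI_ex)
  thus "A ** matrix_inv A = mat 1" "matrix_inv A ** A = mat 1" by auto
qed

text \<open>Cramer's rule applied to the columns of the inverse. It writes each entry as a quotient
  of determinants, from which continuity can be read off.\<close>

lemma matrix_inv_cramer:
  fixes A :: "real^'n^'n"
  assumes "det A \<noteq> 0"
  shows "matrix_inv A = (\<chi> k l. det (\<chi> i j. if j = k then axis l 1 $ i else A $ i $ j) / det A)"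
proof -
  have "A *v (matrix_inv A *v axis l 1) = axis l 1" for l
    using assms matrix_inv_inverse[of A] by (simp add: matrix_vector_mul_assoc invertible_det_nz)
  hence "matrix_inv A *v axis l 1
      = (\<chi> k. det (\<chi> i j. if j = k then axis l 1 $ i else A $ i $ j) / det A)" for l
    using cramer[OF assms] by blast
  moreover have "matrix_inv A $ k $ l = (matrix_inv A *v axis l 1) $ k" for k l
    by (simp add: matrix_vector_mult_basis column_def)
  ultimately show ?thesis by (simp add: vec_eq_iff)
qed

lemma continuous_on_det [continuous_intros]:
  fixes f :: "'a::topological_space \<Rightarrow> real^'n^'n"
  assumes "continuous_on S f"
  shows "continuous_on S (\<lambda>x. det (f x))"
  unfolding det_def by (intro continuous_intros assms)

lemma continuous_on_matrix_inv:
  "continuous_on {A :: real^'n^'n. det A \<noteq> 0} matrix_inv"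
proof -
  have "continuous_on {A :: real^'n^'n. det A \<noteq> 0}
    (\<lambda>A. \<chi> k l. det (\<chi> i j. if j = k then axis l 1 $ i else A $ i $ j) / det A)"
  proof (intro continuous_intros)
    fix k i j l :: 'n
    show "continuous_on {A :: real^'n^'n. det A \<noteq> 0} (\<lambda>A. if j = k then axis l 1 $ i else A $ i $ j)"
      by (cases "j = k") (auto intro!: continuous_intros)
  qed auto
  thus ?thesis by (rule continuous_on_eq) (simp add: matrix_inv_cramer)
qed

section \<open>Lebesgue measure and the standard normal matrix\<close>

lemma nn_integral_lborel_translate:
  fixes h :: "'a::euclidean_space \<Rightarrow> ennreal"
  assumes [measurable]: "h \<in> borel_measurable borel"
  shows "(\<integral>\<^sup>+x. h (x + t) \<partial>lborel) = (\<integral>\<^sup>+x. h x \<partial>lborel)"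
proof -
  have "(\<integral>\<^sup>+x. h x \<partial>lborel) = (\<integral>\<^sup>+x. h x \<partial>distr lborel borel ((+) t))"
    by (simp add: lborel_distr_plus)
  also have "\<dots> = (\<integral>\<^sup>+x. h (x + t) \<partial>lborel)"
    by (subst nn_integral_distr) (auto simp: add.commute)
  finally show ?thesis ..
qed

lemma nn_integral_lborel_reflect:
  fixes h :: "'a::euclidean_space \<Rightarrow> ennreal"
  assumes [measurable]: "h \<in> borel_measurable borel"
  shows "(\<integral>\<^sup>+x. h (t - x) \<partial>lborel) = (\<integral>\<^sup>+x. h x \<partial>lborel)"
proof -
  have "(\<integral>\<^sup>+x. h x \<partial>lborel) = (\<integral>\<^sup>+x. h x \<partial>distr lborel borel (\<lambda>x. t + (-1) *\<^sub>R x))"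
    by (subst lborel_affine[of "-1" t]) (simp_all add: density_1)
  also have "\<dots> = (\<integral>\<^sup>+x. h (t - x) \<partial>lborel)"
    by (subst nn_integral_distr) auto
  finally show ?thesis ..
qed

text \<open>The identity behind uniqueness of translation-invariant measures, applied to
  Lebesgue measure and its image under \<open>f\<close>.\<close>

lemma nn_integral_lborel_linear_cross:
  fixes f :: "'a::euclidean_space \<Rightarrow> 'a" and g h :: "'a \<Rightarrow> ennreal"
  assumes f: "linear f" "bij f"
    and [measurable]: "g \<in> borel_measurable borel" "h \<in> borel_measurable borel"
  shows "(\<integral>\<^sup>+x. h x \<partial>lborel) * (\<integral>\<^sup>+x. g (f x) \<partial>lborel)
       = (\<integral>\<^sup>+x. h (f x) \<partial>lborel) * (\<integral>\<^sup>+x. g x \<partial>lborel)"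
proof -
  have [measurable]: "f \<in> borel_measurable borel"
    using f(1) by (intro borel_measurable_continuous_onI linear_continuous_on)
      (simp add: linear_conv_bounded_linear)
  have "(\<integral>\<^sup>+x. h x \<partial>lborel) * (\<integral>\<^sup>+y. g (f y) \<partial>lborel)
      = (\<integral>\<^sup>+y. (\<integral>\<^sup>+x. h (x + f y) * g (f y) \<partial>lborel) \<partial>lborel)"
    by (simp add: nn_integral_cmult nn_integral_multc nn_integral_lborel_translate[of h])
  also have "\<dots> = (\<integral>\<^sup>+x. (\<integral>\<^sup>+y. h (x + f y) * g (f y) \<partial>lborel) \<partial>lborel)"
    by (rule lborel_pair.Fubini') measurable
  also have "\<dots> = (\<integral>\<^sup>+x. (\<integral>\<^sup>+y. h (f y) * g (f y - x) \<partial>lborel) \<partial>lborel)"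
  proof (rule nn_integral_cong)
    fix x
    \<comment> \<open>Shifting \<open>y\<close> by \<open>inv f x\<close> shifts \<open>f y\<close>
      by \<open>x\<close>, so translation invariance of the inner integral moves \<open>x\<close>
      from \<open>h\<close> to \<open>g\<close>.\<close>
    have x: "f (y + inv f x) = f y + x" for y
      using f by (simp add: linear_add surj_f_inv_f bij_is_surj)
    show "(\<integral>\<^sup>+y. h (x + f y) * g (f y) \<partial>lborel) = (\<integral>\<^sup>+y. h (f y) * g (f y - x) \<partial>lborel)"
      using nn_integral_lborel_translate[of "\<lambda>y. h (f y) * g (f y - x)" "inv f x"]
      by (simp add: x add.commute)
  qed
  also have "\<dots> = (\<integral>\<^sup>+y. (\<integral>\<^sup>+x. h (f y) * g (f y - x) \<partial>lborel) \<partial>lborel)"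
    by (rule lborel_pair.Fubini') measurable
  also have "\<dots> = (\<integral>\<^sup>+x. h (f x) \<partial>lborel) * (\<integral>\<^sup>+x. g x \<partial>lborel)"
    by (simp add: nn_integral_cmult nn_integral_multc nn_integral_lborel_reflect)
  finally show ?thesis .
qed

text \<open>The cross identity for the indicators of a Borel set and of the unit ball shows that the
  image measure is a multiple of Lebesgue measure. The factor is left as a ratio of ball volumes; no
  determinant enters.\<close>

lemma distr_lborel_linear:
  fixes f :: "'a::euclidean_space \<Rightarrow> 'a"
  assumes f: "linear f" "bij f"
  obtains c where "0 < c" "distr lborel borel f = density lborel (\<lambda>_. ennreal c)"
    "ennreal c * emeasure lborel (ball 0 1 :: 'a set) = emeasure lborel (f -` ball 0 1)"
proof -
  have fm[measurable]: "f \<in> borel_measurable borel"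
    using f(1) by (intro borel_measurable_continuous_onI linear_continuous_on)
      (simp add: linear_conv_bounded_linear)
  let ?B = "ball 0 1 :: 'a set"
  have opf: "open (f -` ?B)"
    using f(1) by (intro open_vimage linear_continuous_on) (auto simp: linear_conv_bounded_linear)
  have "0 \<in> f -` ?B" using f by (simp add: linear_0)
  \<comment> \<open>The lower bound makes the preimage of the unit ball bounded, hence of finite
    measure, so that the ratio \<open>c\<close> makes sense.\<close>
  obtain b where b: "b > 0" "\<And>x. b * norm x \<le> norm (f x)"
    using linear_inj_bounded_below_pos[of f] f by (auto simp: bij_is_inj)
  have "f -` ?B \<subseteq> ball 0 (1 / b)"
  proof
    fix x assume "x \<in> f -` ?B"
    hence "b * norm x < 1" using b(2)[of x] by simp
    thus "x \<in> ball 0 (1 / b)" using b(1) by (simp add: field_simps)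
  qed
  hence "emeasure lborel (f -` ?B) \<le> emeasure lborel (ball 0 (1 / b) :: 'a set)"
    by (intro emeasure_mono) auto
  hence fin: "emeasure lborel (f -` ?B) < \<infinity>"
    using emeasure_lborel_ball_finite order_le_less_trans by blast
  have pos: "emeasure lborel U > 0" if "open U" "0 \<in> U" for U :: "'a set"
  proof -
    have "U \<notin> null_sets lborel"
      using that open_not_negligible[of U]
      by (auto simp: negligible_iff_null_sets null_sets_completion_iff)
    thus ?thesis using that by (auto simp: null_sets_def zero_less_iff_neq_zero)
  qed
  define c where "c = measure lborel (f -` ?B) / measure lborel ?B"
  have meas: "emeasure lborel (f -` ?B) = measure lborel (f -` ?B)"
      "emeasure lborel ?B = measure lborel ?B"
    using fin emeasure_lborel_ball_finite[of "0::'a" 1] by (auto intro!: emeasure_eq_ennreal_measure)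
  have mpos: "measure lborel ?B > 0" "measure lborel (f -` ?B) > 0"
    using pos[of ?B] pos[of "f -` ?B"] opf \<open>0 \<in> f -` ?B\<close> unfolding meas by auto
  have c: "0 < c" using mpos by (simp add: c_def)
  have cB: "ennreal c * emeasure lborel ?B = emeasure lborel (f -` ?B)"
    unfolding meas using mpos by (simp add: c_def ennreal_mult[symmetric])
  have "distr lborel borel f = density lborel (\<lambda>_. ennreal c)"
  proof (rule measure_eqI)
    fix X assume "X \<in> sets (distr lborel borel f)"
    hence [measurable]: "X \<in> sets borel" by simp
    have [measurable]: "f -` Y \<in> sets borel" if "Y \<in> sets borel" for Y
      using measurable_sets[OF fm that] by simp
    have ind: "indicator Y (f x) = (indicator (f -` Y) x :: ennreal)" for Y x
      by (simp add: indicator_def)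
    have "emeasure lborel X * emeasure lborel (f -` ?B) = emeasure lborel (f -` X) * emeasure lborel ?B"
      using nn_integral_lborel_linear_cross[OF f borel_measurable_indicator borel_measurable_indicator, of ?B X]
      by (simp add: ind)
    hence "(ennreal c * emeasure lborel X) * emeasure lborel ?B = emeasure lborel (f -` X) * emeasure lborel ?B"
      by (simp add: cB[symmetric] mult_ac)
    hence "ennreal c * emeasure lborel X = emeasure lborel (f -` X)"
      using mpos unfolding meas(2) by (metis mult_divide_eq_ennreal ennreal_neq_top ennreal_eq_0_iff not_le)
    thus "emeasure (distr lborel borel f) X = emeasure (density lborel (\<lambda>_. ennreal c)) X"
      by (simp add: emeasure_distr emeasure_density_const)
  qed simp
  thus thesis using that c cB by blast
qed

text \<open>The unit ball is its own preimage and has positive finite volume, so the factor of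
  \<open>distr_lborel_linear\<close> is 1.\<close>

lemma distr_lborel_orthogonal_transformation:
  fixes f :: "'a::euclidean_space \<Rightarrow> 'a"
  assumes "orthogonal_transformation f"
  shows "distr lborel borel f = lborel"
proof -
  have f: "linear f" "bij f" "\<And>x. norm (f x) = norm x"
    using assms by (auto simp: orthogonal_transformation_bij orthogonal_transformation_linear orthogonal_transformation_norm)
  obtain c where c: "0 < c" "distr lborel borel f = density lborel (\<lambda>_. ennreal c)"
    "ennreal c * emeasure lborel (ball 0 1 :: 'a set) = emeasure lborel (f -` ball 0 1)"
    using distr_lborel_linear[OF f(1,2)] by blast
  have "f -` ball 0 1 = ball 0 1" using f(3) by auto
  hence eq: "ennreal c * emeasure lborel (ball 0 1 :: 'a set) = 1 * emeasure lborel (ball 0 1 :: 'a set)"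
    using c(3) by simp
  have "emeasure lborel (ball 0 1 :: 'a set) \<noteq> 0"
    using open_not_negligible[of "ball 0 1 :: 'a set"]
    by (auto simp: negligible_iff_null_sets null_sets_completion_iff null_sets_def)
  hence "ennreal c = 1"
    using eq emeasure_lborel_ball_finite[of "0::'a" 1]
    by (metis mult_divide_eq_ennreal infinity_ennreal_def order_less_irrefl)
  thus ?thesis by (simp add: c(2) density_1)
qed

section \<open>The Lebesgue density of the standard normal matrix\<close>

lemma borel_measurable_matrix_lambda [measurable (raw)]:
  assumes "\<And>i j. (\<lambda>x. f x i j) \<in> borel_measurable M"
  shows "(\<lambda>x. (\<chi> i j. f x i j) :: real^'p^'n) \<in> borel_measurable M"
  using assms by (subst borel_measurable_euclidean_space) (auto simp: Basis_vec_def inner_axis)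

lemma bij_betw_matrix_Basis:
  "bij_betw (\<lambda>(i, j). axis i (axis j 1)) UNIV (Basis :: (real^'p^'n) set)"
  unfolding bij_betw_def
  by (auto simp: inj_on_def Basis_vec_def axis_eq_axis)

text \<open>Both measures give a box the product of its side lengths. This connects the entrywise
  product in \<open>std_matrix_normal\<close> with Lebesgue measure on the matrix space.\<close>

lemma lborel_matrix:
  "(lborel :: (real^'p^'n) measure)
    = distr (\<Pi>\<^sub>M ij \<in> (UNIV :: ('n \<times> 'p) set). lborel) borel (\<lambda>z. \<chi> i j. z (i, j))"
proof (rule lborel_eqI)
  interpret product_sigma_finite "\<lambda>_ :: 'n \<times> 'p. lborel :: real measure" ..
  fix l u :: "real^'p^'n"
  assume le: "\<And>b. b \<in> Basis \<Longrightarrow> l \<bullet> b \<le> u \<bullet> b"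
  have le': "l $ i $ j \<le> u $ i $ j" for i j
    using le[of "axis i (axis j 1)"] by (auto simp: Basis_vec_def inner_axis)
  have [measurable]: "(\<lambda>z. \<chi> i j. z (i, j)) \<in> borel_measurable (\<Pi>\<^sub>M ij \<in> (UNIV :: ('n \<times> 'p) set). (lborel :: real measure))"
    by measurable
  have "(\<lambda>z. \<chi> i j. z (i, j)) -` box l u \<inter> space (\<Pi>\<^sub>M ij \<in> (UNIV :: ('n \<times> 'p) set). lborel)
    = (\<Pi>\<^sub>E ij\<in>UNIV. {l $ fst ij $ snd ij <..< u $ fst ij $ snd ij})"
    by (auto simp: mem_box Basis_vec_def inner_axis space_PiM PiE_UNIV_domain Pi_iff)
  hence "emeasure (distr (\<Pi>\<^sub>M ij \<in> (UNIV :: ('n \<times> 'p) set). lborel) borel (\<lambda>z. \<chi> i j. z (i, j))) (box l u)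
    = emeasure (\<Pi>\<^sub>M ij \<in> (UNIV :: ('n \<times> 'p) set). lborel)
        (\<Pi>\<^sub>E ij\<in>UNIV. {l $ fst ij $ snd ij <..< u $ fst ij $ snd ij})"
    by (subst emeasure_distr) simp_all
  also have "\<dots> = (\<Prod>ij\<in>UNIV. emeasure lborel {l $ fst ij $ snd ij <..< u $ fst ij $ snd ij})"
    by (rule emeasure_PiM) auto
  also have "\<dots> = (\<Prod>ij\<in>UNIV. ennreal (u $ fst ij $ snd ij - l $ fst ij $ snd ij))"
    by (simp add: le')
  also have "\<dots> = (\<Prod>ij\<in>UNIV. (u - l) \<bullet> (case ij of (i, j) \<Rightarrow> axis i (axis j 1)))"
    by (subst prod_ennreal) (auto simp: le' inner_axis case_prod_beta intro!: arg_cong[of _ _ ennreal] prod.cong)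
  also have "\<dots> = (\<Prod>b\<in>Basis. (u - l) \<bullet> b)"
    by (subst prod.reindex_bij_betw[OF bij_betw_matrix_Basis]) simp
  finally show "emeasure (distr (\<Pi>\<^sub>M ij \<in> (UNIV :: ('n \<times> 'p) set). lborel) borel (\<lambda>z. \<chi> i j. z (i, j))) (box l u)
    = (\<Prod>b\<in>Basis. (u - l) \<bullet> b)" .
qed simp

text \<open>The product measure is determined by rectangles, on which the integral of the product
  density factorises.\<close>

lemma (in product_sigma_finite) PiM_density:
  assumes I: "finite I" and f: "\<And>i. i \<in> I \<Longrightarrow> f i \<in> borel_measurable (M i)"
    and fin: "\<And>i. sigma_finite_measure (density (M i) (f i))"
  shows "(\<Pi>\<^sub>M i\<in>I. density (M i) (f i)) = density (\<Pi>\<^sub>M i\<in>I. M i) (\<lambda>x. \<Prod>i\<in>I. f i (x i))"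
proof -
  interpret D: product_sigma_finite "\<lambda>i. density (M i) (f i)"
    using fin by (simp add: product_sigma_finite_def)
  note f[measurable]
  show ?thesis
  proof (rule D.PiM_eqI[OF I, symmetric])
    fix A assume A: "\<And>i. i \<in> I \<Longrightarrow> A i \<in> sets (density (M i) (f i))"
    hence [measurable]: "i \<in> I \<Longrightarrow> A i \<in> sets (M i)" for i by simp
    have "emeasure (density (PiM I M) (\<lambda>x. \<Prod>i\<in>I. f i (x i))) (Pi\<^sub>E I A)
      = (\<integral>\<^sup>+x. (\<Prod>i\<in>I. f i (x i)) * indicator (Pi\<^sub>E I A) x \<partial>PiM I M)"
      using I by (intro emeasure_density) (auto intro!: sets_PiM_I_finite)
    also have "\<dots> = (\<integral>\<^sup>+x. (\<Prod>i\<in>I. f i (x i) * indicator (A i) (x i)) \<partial>PiM I M)"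
      using I by (intro nn_integral_cong)
        (auto simp: prod.distrib space_PiM indicator_def PiE_iff prod_zero_iff)
    also have "\<dots> = (\<Prod>i\<in>I. \<integral>\<^sup>+x. f i x * indicator (A i) x \<partial>M i)"
      using I by (intro product_nn_integral_prod) auto
    also have "\<dots> = (\<Prod>i\<in>I. emeasure (density (M i) (f i)) (A i))"
      by (intro prod.cong refl) (simp add: emeasure_density)
    finally show "emeasure (density (PiM I M) (\<lambda>x. \<Prod>i\<in>I. f i (x i))) (Pi\<^sub>E I A)
      = (\<Prod>i\<in>I. emeasure (density (M i) (f i)) (A i))" .
  qed (auto intro!: sets_PiM_cong)
qed

definition gaussian_const :: "'a::euclidean_space itself \<Rightarrow> real" where
  "gaussian_const _ = (1 / sqrt (2 * pi)) ^ DIM('a)"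

lemma norm_matrix_square:
  "(norm (Z :: real^'p^'n))\<^sup>2 = (\<Sum>ij\<in>UNIV. (Z $ fst ij $ snd ij)\<^sup>2)"
  by (simp add: norm_vec_def L2_set_def sum_nonneg sum.cartesian_product case_prod_beta flip: UNIV_Times_UNIV)

lemma std_matrix_normal_density:
  "(std_matrix_normal :: (real^'p^'n) measure)
    = density lborel (\<lambda>Z. ennreal (gaussian_const TYPE(real^'p^'n) * exp (- (norm Z)\<^sup>2 / 2)))"
proof -
  interpret product_sigma_finite "\<lambda>_ :: 'n \<times> 'p. lborel :: real measure" ..
  have gauss: "(\<Prod>ij\<in>UNIV. std_normal_density (Z $ fst ij $ snd ij))
      = gaussian_const TYPE(real^'p^'n) * exp (- (norm Z)\<^sup>2 / 2)" for Z :: "real^'p^'n"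
  proof -
    have "(\<Prod>ij\<in>UNIV. std_normal_density (Z $ fst ij $ snd ij))
        = (1 / sqrt (2 * pi)) ^ CARD('n \<times> 'p) * exp (\<Sum>ij\<in>UNIV. - (Z $ fst ij $ snd ij)\<^sup>2 / 2)"
      unfolding std_normal_density_def prod.distrib by (simp add: exp_sum)
    also have "(\<Sum>ij\<in>UNIV. - (Z $ fst ij $ snd ij)\<^sup>2 / 2) = - (norm Z)\<^sup>2 / 2"
      unfolding norm_matrix_square by (simp add: sum_negf flip: sum_divide_distrib)
    finally show ?thesis by (simp add: gaussian_const_def)
  qed
  have gauss': "(\<Prod>ij\<in>UNIV. std_normal_density (z ij))
      = gaussian_const TYPE(real^'p^'n) * exp (- (norm (\<chi> i j. z (i, j) :: real^'p^'n))\<^sup>2 / 2)" for z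
    using gauss[of "\<chi> i j. z (i, j)"] by simp
  have "sigma_finite_measure (density lborel (\<lambda>x. ennreal (std_normal_density x)))"
    using prob_space_normal_density[of 1 0] prob_space.axioms(1) finite_measure.axioms(1)
    by (auto simp: prob_space_def finite_measure_def)
  hence "(\<Pi>\<^sub>M ij \<in> (UNIV :: ('n \<times> 'p) set). density lborel (\<lambda>x. ennreal (std_normal_density x)))
    = density (\<Pi>\<^sub>M ij \<in> (UNIV :: ('n \<times> 'p) set). lborel) (\<lambda>z. \<Prod>ij\<in>UNIV. ennreal (std_normal_density (z ij)))"
    by (intro PiM_density) auto
  also have "\<dots> = density (\<Pi>\<^sub>M ij \<in> (UNIV :: ('n \<times> 'p) set). lborel)
      (\<lambda>z. (\<lambda>Z :: real^'p^'n. ennreal (gaussian_const TYPE(real^'p^'n) * exp (- (norm Z)\<^sup>2 / 2))) (\<chi> i j. z (i, j)))"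
    by (simp add: prod_ennreal gauss')
  finally show ?thesis
    unfolding std_matrix_normal_def
    by (subst lborel_matrix, subst density_distr) (simp_all add: o_def)
qed

section \<open>Matrix multiplication and rotation invariance\<close>

lemma bounded_bilinear_matrix_mult:
  "bounded_bilinear ((**) :: real^'n^'m \<Rightarrow> real^'p^'n \<Rightarrow> real^'p^'m)"
  unfolding bilinear_conv_bounded_bilinear[symmetric] bilinear_def
  by (auto intro!: linearI simp: matrix_matrix_mult_def vec_eq_iff sum_distrib_left sum.distrib
      algebra_simps)

lemmas continuous_on_matrix_mult [continuous_intros] =
  bounded_bilinear.continuous_on[OF bounded_bilinear_matrix_mult]

lemma borel_measurable_matrix_mult [measurable]:
  fixes f :: "'a \<Rightarrow> real^'n^'m" and g :: "'a \<Rightarrow> real^'p^'n"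
  assumes "f \<in> borel_measurable M" "g \<in> borel_measurable M"
  shows "(\<lambda>x. f x ** g x) \<in> borel_measurable M"
  using assms by (rule borel_measurable_continuous_Pair) (intro continuous_intros)

lemma norm_transpose: "norm (transpose A) = norm (A :: real^'p^'n)"
proof -
  have "(norm (transpose A))\<^sup>2 = (norm A)\<^sup>2"
    by (simp add: norm_vec_def L2_set_def sum_nonneg transpose_def) (rule sum.swap)
  thus ?thesis by simp
qed

text \<open>The norm is the Frobenius norm, and multiplication by \<open>Q\<close> from the right
  applies the isometry \<open>transpose Q\<close> to each row.\<close>

lemma norm_mult_orthogonal_matrix_right:
  fixes Z :: "real^'p^'n"
  assumes "orthogonal_matrix Q"
  shows "norm (Z ** Q) = norm Z"
proof -
  have "orthogonal_transformation ((*v) (transpose Q))"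
    using assms by (simp add: orthogonal_transformation_matrix orthogonal_matrix_transpose)
  moreover have "(Z ** Q) $ i = transpose Q *v (Z $ i)" for i
    by (simp add: vec_eq_iff matrix_matrix_mult_def matrix_vector_mult_def transpose_def mult.commute)
  ultimately have "norm ((Z ** Q) $ i) = norm (Z $ i)" for i
    by (simp add: orthogonal_transformation_norm del: transpose_matrix_vector)
  thus ?thesis by (simp add: norm_vec_def[where 'a="real^'p"])
qed

lemma
  assumes "orthogonal_matrix Q"
  shows orthogonal_transformation_matrix_mult_right: "orthogonal_transformation (\<lambda>Z :: real^'p^'n. Z ** Q)"
    and orthogonal_transformation_matrix_mult_left: "orthogonal_transformation (\<lambda>Z :: real^'n^'p. Q ** Z)"
proof -
  have "linear (\<lambda>Z :: real^'p^'n. Z ** Q)" "linear (\<lambda>Z :: real^'n^'p. Q ** Z)"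
    by (simp_all add: linear_conv_bounded_linear bounded_bilinear.bounded_linear_left[OF bounded_bilinear_matrix_mult]
        bounded_bilinear.bounded_linear_right[OF bounded_bilinear_matrix_mult])
  \<comment> \<open>Transposition preserves the norm and reduces the left factor to a right
    factor.\<close>
  moreover have "norm (Q ** Z) = norm Z" for Z :: "real^'n^'p"
    using norm_mult_orthogonal_matrix_right[of "transpose Q" "transpose Z"] assms
    by (simp add: orthogonal_matrix_transpose norm_transpose flip: matrix_transpose_mul)
  moreover have "norm (Z ** Q) = norm Z" for Z :: "real^'p^'n"
    by (rule norm_mult_orthogonal_matrix_right[OF assms])
  ultimately show "orthogonal_transformation (\<lambda>Z :: real^'p^'n. Z ** Q)"
    "orthogonal_transformation (\<lambda>Z :: real^'n^'p. Q ** Z)"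
    by (simp_all add: orthogonal_transformation)
qed

lemma prob_space_std_matrix_normal: "prob_space (std_matrix_normal :: (real^'p^'n) measure)"
proof -
  interpret prob_space "density lborel (\<lambda>x. ennreal (std_normal_density x))"
    by (simp add: prob_space_normal_density)
  show ?thesis
    unfolding std_matrix_normal_def
    by (intro prob_space.prob_space_distr prob_space_PiM prob_space_axioms) measurable
qed

lemma
  shows sets_std_matrix_normal [simp, measurable_cong]: "sets std_matrix_normal = sets borel"
    and space_std_matrix_normal [simp]: "space std_matrix_normal = UNIV"
  by (simp_all add: std_matrix_normal_def)

lemma AE_std_matrix_normal:
  assumes "AE Z in lborel. P (Z :: real^'p^'n)" shows "AE Z in std_matrix_normal. P Z"
  unfolding std_matrix_normal_density using assms by (auto simp: AE_density)

text \<open>The Gaussian density is strictly positive, so a null set of the normal law is Lebesgue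
  null.\<close>

lemma AE_lborel_std_matrix_normal:
  assumes "AE Z in std_matrix_normal. P (Z :: real^'p^'n)" shows "AE Z in lborel. P Z"
  using assms unfolding std_matrix_normal_density
  by (auto simp: AE_density gaussian_const_def)

text \<open>The density depends on the norm alone, and orthogonal maps preserve both the norm and
  Lebesgue measure.\<close>

lemma distr_std_matrix_normal_orthogonal:
  fixes f :: "real^'p^'n \<Rightarrow> real^'p^'n"
  assumes "orthogonal_transformation f"
  shows "distr std_matrix_normal borel f = std_matrix_normal"
proof -
  have [measurable]: "f \<in> borel_measurable borel"
    using assms by (intro borel_measurable_continuous_onI linear_continuous_on)
      (simp add: orthogonal_transformation linear_conv_bounded_linear)
  let ?h = "\<lambda>Z :: real^'p^'n. ennreal (gaussian_const TYPE(real^'p^'n) * exp (- (norm Z)\<^sup>2 / 2))"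
  have "distr (density lborel (\<lambda>Z. ?h (f Z))) borel f = density (distr lborel borel f) ?h"
    by (subst density_distr) simp_all
  thus ?thesis
    using assms by (simp add: std_matrix_normal_density distr_lborel_orthogonal_transformation
        orthogonal_transformation_norm)
qed

section \<open>Submatrices of a normal matrix\<close>

lemma borel_measurable_matrix_nth [measurable]:
  "(\<lambda>Z :: real^'p^'n. Z $ i $ j) \<in> borel_measurable borel"
  by (intro borel_measurable_continuous_onI continuous_intros)

text \<open>Injectivity of the index maps means that no entry is repeated, so the selected entries
  are again i.i.d. standard normal.\<close>

lemma distr_std_matrix_normal_submatrix:
  fixes \<sigma> :: "'m::finite \<Rightarrow> 'n::finite" and \<tau> :: "'k::finite \<Rightarrow> 'p::finite"
  assumes "inj \<sigma>" "inj \<tau>"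
  shows "distr (std_matrix_normal :: (real^'p^'n) measure) borel (\<lambda>Z. \<chi> i j. Z $ \<sigma> i $ \<tau> j)
    = (std_matrix_normal :: (real^'k^'m) measure)"
proof -
  let ?N = "density lborel (\<lambda>x. ennreal (std_normal_density x))"
  interpret prob_space ?N
    by (simp add: prob_space_normal_density)
  have "distr (\<Pi>\<^sub>M ij \<in> (UNIV :: ('n \<times> 'p) set). ?N) (\<Pi>\<^sub>M ij \<in> (UNIV :: ('m \<times> 'k) set). ?N)
      (\<lambda>z. \<lambda>ij\<in>UNIV. z (map_prod \<sigma> \<tau> ij)) = (\<Pi>\<^sub>M ij \<in> (UNIV :: ('m \<times> 'k) set). ?N)"
    using assms distr_PiM_reindex[of UNIV "\<lambda>_. ?N" "map_prod \<sigma> \<tau>" UNIV] prob_space_axioms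
    by (simp add: prod.inj_map)
  hence "(std_matrix_normal :: (real^'k^'m) measure)
    = distr (distr (\<Pi>\<^sub>M ij \<in> (UNIV :: ('n \<times> 'p) set). ?N) (\<Pi>\<^sub>M ij \<in> (UNIV :: ('m \<times> 'k) set). ?N)
      (\<lambda>z. \<lambda>ij\<in>UNIV. z (map_prod \<sigma> \<tau> ij))) borel (\<lambda>z. \<chi> i j. z (i, j))"
    by (simp add: std_matrix_normal_def)
  also have "\<dots> = distr (\<Pi>\<^sub>M ij \<in> (UNIV :: ('n \<times> 'p) set). ?N) borel (\<lambda>z. \<chi> i j. z (\<sigma> i, \<tau> j))"
    by (subst distr_distr) (simp_all add: o_def)
  also have "\<dots> = distr (std_matrix_normal :: (real^'p^'n) measure) borel (\<lambda>Z. \<chi> i j. Z $ \<sigma> i $ \<tau> j)"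
    unfolding std_matrix_normal_def by (subst distr_distr) (simp_all add: o_def)
  finally show ?thesis ..
qed

text \<open>Expresses the choice of columns, or of rows after transposition, as a matrix product,
  which can then be reassociated with the other factors.\<close>

definition selection_matrix :: "('p \<Rightarrow> 'n) \<Rightarrow> real^'p^'n" where
  "selection_matrix h = (\<chi> i j. if i = h j then 1 else 0)"

lemma mult_selection_matrix:
  "(Z :: real^'n^'m) ** selection_matrix h = (\<chi> i j. Z $ i $ h j)"
  by (simp add: vec_eq_iff matrix_matrix_mult_def selection_matrix_def if_distrib cong: if_cong)

lemma transpose_selection_matrix_mult:
  "transpose (selection_matrix h) ** (Z :: real^'m^'n) = (\<chi> i j. Z $ h i $ j)"
  by (simp add: vec_eq_iff matrix_matrix_mult_def selection_matrix_def transpose_def if_distrib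
      if_distribR cong: if_cong)

lemma selection_matrix_orthonormal:
  "inj h \<Longrightarrow> transpose (selection_matrix h) ** selection_matrix h = mat 1"
  unfolding transpose_selection_matrix_mult
  by (auto simp: selection_matrix_def mat_def vec_eq_iff inj_eq)

section \<open>Singular matrices form a null set\<close>

text \<open>A singular matrix has a row \<open>i\<close> in the span of the other \<open>n - 1\<close> rows. The coefficients are
  stored in row \<open>i\<close> itself, so that these matrices form a smooth image of a hyperplane.\<close>

lemma negligible_singular: "negligible {Z :: real^'n^'n. det Z = 0}"
proof -
  \<comment> \<open>Row \<open>i\<close> stores coefficients for the other rows only, so its
    diagonal slot can be fixed at 0; this makes the parameter set a hyperplane.\<close>
  define S where "S i = {Z :: real^'n^'n. axis i (axis i 1) \<bullet> Z = 0}" for i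
  define f where "f i Z = Z - axis i (Z $ i) + (\<Sum>j\<in>UNIV - {i}. Z $ i $ j *\<^sub>R axis i (Z $ j))"
    for i and Z :: "real^'n^'n"
  have "negligible (f i ` S i)" for i
  proof (rule negligible_differentiable_image_negligible)
    show "negligible (S i)"
      unfolding S_def by (rule negligible_hyperplane) (simp add: axis_eq_0_iff)
    have lin: "bounded_linear (\<lambda>Z :: real^'n^'n. axis i (Z $ j) :: real^'n^'n)"
        "bounded_linear (\<lambda>Z :: real^'n^'n. Z $ i $ j)" for j
      by (auto simp: axis_def vec_eq_iff intro!: linearI simp flip: linear_conv_bounded_linear)
    show "f i differentiable_on S i"
      unfolding f_def differentiable_on_def
      by (intro ballI differentiable_add differentiable_diff differentiable_sum differentiable_scaleR
          differentiable_ident bounded_linear_imp_differentiable lin) auto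
  qed simp
  hence "negligible (\<Union>i. f i ` S i)"
    by (intro negligible_Union) auto
  moreover have "{Z. det Z = 0} \<subseteq> (\<Union>i. f i ` S i)"
  proof
    fix Z :: "real^'n^'n" assume "Z \<in> {Z. det Z = 0}"
    hence "\<not> invertible Z" by (simp add: invertible_det_nz)
    then obtain c i where c: "(\<Sum>k\<in>UNIV. c k *s row k Z) = 0" "c i \<noteq> 0"
      unfolding invertible_right_inverse matrix_right_invertible_independent_rows by blast
    \<comment> \<open>Solves the dependence relation for row \<open>i\<close>, which is possible as
      \<open>c i \<noteq> 0\<close>.\<close>
    define d where "d j = - c j / c i" for j
    define W where "W = (\<chi> k. if k = i then (\<chi> j. if j = i then 0 else d j) else Z $ k)"
    have "W \<in> S i" by (simp add: S_def W_def inner_axis' )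
    moreover have "f i W = Z"
    proof -
      have "c i *\<^sub>R Z $ i + (\<Sum>k\<in>UNIV - {i}. c k *\<^sub>R Z $ k) = 0"
        using c(1) by (simp add: sum.remove[of UNIV i] row_def vec_lambda_eta scalar_mult_eq_scaleR)
      hence "c i *\<^sub>R Z $ i = (\<Sum>k\<in>UNIV - {i}. (- c k) *\<^sub>R Z $ k)"
        by (simp add: sum_negf add_eq_0_iff2)
      hence "(1 / c i) *\<^sub>R (c i *\<^sub>R Z $ i) = (\<Sum>k\<in>UNIV - {i}. d k *\<^sub>R Z $ k)"
        by (simp add: scaleR_sum_right d_def)
      hence "(\<Sum>k\<in>UNIV - {i}. d k *\<^sub>R Z $ k) = Z $ i" using c(2) by simp
      moreover have ax: "linear (\<lambda>v :: real^'n. axis i v :: real^'n^'n)"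
        by (auto simp: axis_def vec_eq_iff intro!: linearI)
      have "(\<Sum>j\<in>UNIV - {i}. W $ i $ j *\<^sub>R axis i (W $ j)) = (\<Sum>j\<in>UNIV - {i}. axis i (d j *\<^sub>R Z $ j))"
        by (intro sum.cong) (simp_all add: W_def linear_scale[OF ax])
      moreover have "\<dots> = axis i (\<Sum>j\<in>UNIV - {i}. d j *\<^sub>R Z $ j)"
        by (simp add: linear_sum[OF ax])
      ultimately show ?thesis
        by (simp add: f_def) (auto simp: W_def vec_eq_iff axis_def)
    qed
    ultimately show "Z \<in> (\<Union>i. f i ` S i)" by blast
  qed
  ultimately show ?thesis by (rule negligible_subset)
qed

lemma AE_lborel_negligible:
  assumes "negligible {x. \<not> P x}" shows "AE x in lborel. P x"
  using assms AE_I'[of "{x. \<not> P x}" lebesgue P]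
  by (simp add: negligible_iff_null_sets AE_completion_iff)

lemma AE_lborel_det: "AE Z in lborel. det (Z :: real^'n^'n) \<noteq> 0"
  by (rule AE_lborel_negligible) (simp add: negligible_singular)


section \<open>Continuity of the power\<close>

text \<open>Up to a constant factor, the integral of \<open>f\<close> against the law of \<open>S ** Z\<close>, \<open>T\<close> being the
  inverse of \<open>S\<close>.\<close>

definition gaussian_integral :: "(real^'p^'n \<Rightarrow> real) \<Rightarrow> real^'n^'n \<Rightarrow> real" where
  "gaussian_integral f T = (\<integral>Y. f Y * exp (- (norm (T ** Y))\<^sup>2 / 2) \<partial>lborel)"

lemma linear_matrix_mult_left: "linear (\<lambda>Z :: real^'p^'n. (S :: real^'n^'m) ** Z)"
  by (simp add: linear_conv_bounded_linear bounded_bilinear.bounded_linear_right[OF bounded_bilinear_matrix_mult])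

text \<open>Substitution \<open>Y = S ** Z\<close> in the Gaussian integral. The factor
  \<open>k\<close> contains an unspecified Jacobian, but it is the same for all \<open>f\<close> and
  therefore cancels in quotients.\<close>

lemma integral_std_matrix_normal_mult:
  fixes S :: "real^'n^'n"
  assumes S: "invertible S"
  obtains k where "0 < k"
    "\<And>f :: real^'p^'n \<Rightarrow> real. f \<in> borel_measurable borel \<Longrightarrow>
      (\<integral>Z. f (S ** Z) \<partial>std_matrix_normal) = k * gaussian_integral f (matrix_inv S)"
    "integrable lborel (\<lambda>Y :: real^'p^'n. exp (- (norm (matrix_inv S ** Y))\<^sup>2 / 2))"
proof -
  let ?m = "\<lambda>Z :: real^'p^'n. S ** Z"
  let ?T = "matrix_inv S"
  have inv: "?T ** (S ** Z) = Z" "S ** (?T ** Z) = Z" for Z :: "real^'p^'n"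
    by (simp_all add: matrix_mul_assoc matrix_inv_inverse[OF S])
  hence "bij ?m" by (intro o_bij[of "\<lambda>Z. ?T ** Z"]) auto
  then obtain c where c: "0 < c" "distr lborel borel ?m = density lborel (\<lambda>_. ennreal c)"
    using distr_lborel_linear[OF linear_matrix_mult_left] by metis
  let ?K = "gaussian_const TYPE(real^'p^'n)"
  have K: "0 < ?K" by (simp add: gaussian_const_def)
  have "(\<integral>Z. f (S ** Z) \<partial>std_matrix_normal) = ?K * c * gaussian_integral f ?T"
    if [measurable]: "f \<in> borel_measurable borel" for f :: "real^'p^'n \<Rightarrow> real"
  proof -
    let ?g = "\<lambda>Y. f Y * exp (- (norm (?T ** Y))\<^sup>2 / 2)"
    have "(\<integral>Z. f (S ** Z) \<partial>std_matrix_normal) = (\<integral>Z. ?K * ?g (S ** Z) \<partial>lborel)"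
      unfolding std_matrix_normal_density using K
      by (subst integral_density) (auto simp: inv mult_ac)
    also have "\<dots> = ?K * (\<integral>Y. ?g Y \<partial>distr lborel borel ?m)"
      by (subst integral_distr) simp_all
    also have "(\<integral>Y. ?g Y \<partial>distr lborel borel ?m) = c * gaussian_integral f ?T"
      unfolding c(2) gaussian_integral_def using c(1)
      by (subst integral_density) simp_all
    finally show ?thesis by simp
  qed
  moreover have "integrable lborel (\<lambda>Y :: real^'p^'n. exp (- (norm (?T ** Y))\<^sup>2 / 2))"
  proof -
    interpret prob_space "std_matrix_normal :: (real^'p^'n) measure"
      by (rule prob_space_std_matrix_normal)
    have "integrable (std_matrix_normal :: (real^'p^'n) measure) (\<lambda>_. 1 :: real)" by simp
    hence "integrable lborel (\<lambda>Z :: real^'p^'n. ?K * exp (- (norm Z)\<^sup>2 / 2))"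
      unfolding std_matrix_normal_density using K by (subst (asm) integrable_density) auto
    hence "integrable lborel (\<lambda>Z :: real^'p^'n. exp (- (norm (?T ** (S ** Z)))\<^sup>2 / 2))"
      using K by (simp add: inv)
    hence "integrable (distr lborel borel ?m) (\<lambda>Y :: real^'p^'n. exp (- (norm (?T ** Y))\<^sup>2 / 2))"
      by (subst integrable_distr_eq) simp_all
    thus ?thesis
      unfolding c(2) using c(1) by (subst (asm) integrable_density) auto
  qed
  ultimately show thesis using that[of "?K * c"] K c(1) by simp
qed

lemma invertible_matrix_inv:
  fixes A :: "real^'n^'n"
  assumes "invertible A"
  shows "invertible (matrix_inv A)" "matrix_inv (matrix_inv A) = A"
proof -
  show inv: "invertible (matrix_inv A)"
    unfolding invertible_def using matrix_inv_inverse[OF assms] by blast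
  have "matrix_inv (matrix_inv A) = (A ** matrix_inv A) ** matrix_inv (matrix_inv A)"
    by (simp add: matrix_inv_inverse[OF assms])
  also have "\<dots> = A"
    by (simp only: matrix_mul_assoc[symmetric] matrix_inv_inverse[OF inv] matrix_mul_rid)
  finally show "matrix_inv (matrix_inv A) = A" .
qed

text \<open>Dominated convergence: for matrices close to \<open>T\<close>, the Gaussian factor is at
  most the one belonging to \<open>T / 2\<close>, which is integrable.\<close>

lemma tendsto_gaussian_integral:
  fixes f :: "real^'p^'n \<Rightarrow> real" and T :: "real^'n^'n"
  assumes f[measurable]: "f \<in> borel_measurable borel" and bound: "\<And>Y. \<bar>f Y\<bar> \<le> M"
    and T: "invertible T" and X: "X \<longlonglongrightarrow> T"
  shows "(\<lambda>k. gaussian_integral f (X k)) \<longlonglongrightarrow> gaussian_integral f T"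
proof -
  have M: "0 \<le> M" using bound[of undefined] by linarith
  obtain b where b: "b > 0" "\<And>(A :: real^'n^'n) (Y :: real^'p^'n). norm (A ** Y) \<le> norm A * norm Y * b"
    using bounded_bilinear.pos_bounded[OF bounded_bilinear_matrix_mult] by metis
  define T2 where "T2 = (1 / 2) *\<^sub>R T"
  have T2: "T2 ** Y = (1 / 2) *\<^sub>R (T ** Y)" for Y :: "real^'p^'n"
    by (simp add: T2_def bounded_bilinear.scaleR_left[OF bounded_bilinear_matrix_mult])
  have "T2 ** (2 *\<^sub>R matrix_inv T) = mat 1"
    by (simp add: T2_def bounded_bilinear.scaleR_left[OF bounded_bilinear_matrix_mult]
      bounded_bilinear.scaleR_right[OF bounded_bilinear_matrix_mult] matrix_inv_inverse[OF T])
  hence "invertible T2" by (auto simp: invertible_right_inverse)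
  then obtain S where S: "invertible S" "matrix_inv S = T2"
    using invertible_matrix_inv by blast
  have int: "integrable lborel (\<lambda>Y :: real^'p^'n. M * exp (- (norm (T2 ** Y))\<^sup>2 / 2))"
    using integral_std_matrix_normal_mult[OF S(1)] unfolding S(2) by (metis integrable_mult_right)
  \<comment> \<open>Chosen so that \<open>norm (A - T) < e\<close> gives
    \<open>norm (A ** Y - T ** Y) \<le> norm (T ** Y) / 2\<close>. One factor \<open>b\<close> comes
    from each of two product estimates, and the \<open>+ 1\<close> keeps the denominator visibly
    positive.\<close>
  define e where "e = 1 / (2 * (b * b * (norm (matrix_inv T) + 1)))"
  have e: "e > 0" unfolding e_def using b(1) by (auto intro!: divide_pos_pos mult_pos_pos add_nonneg_pos)
  have half: "norm (T2 ** Y) \<le> norm (A ** Y)" if "norm (A - T) < e" for A and Y :: "real^'p^'n"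
  proof -
    have "norm Y = norm (matrix_inv T ** (T ** Y))"
      by (simp add: matrix_mul_assoc matrix_inv_inverse[OF T])
    also have "\<dots> \<le> norm (matrix_inv T) * norm (T ** Y) * b" by (rule b(2))
    also have "\<dots> \<le> (norm (matrix_inv T) + 1) * norm (T ** Y) * b"
      using b(1) by (intro mult_right_mono) auto
    finally have Y: "norm Y \<le> (norm (matrix_inv T) + 1) * norm (T ** Y) * b" .
    have "norm (A ** Y - T ** Y) = norm ((A - T) ** Y)"
      by (simp add: bounded_bilinear.diff_left[OF bounded_bilinear_matrix_mult])
    also have "\<dots> \<le> norm (A - T) * norm Y * b" by (rule b(2))
    also have "\<dots> \<le> e * ((norm (matrix_inv T) + 1) * norm (T ** Y) * b) * b"
      using that b(1) e Y by (intro mult_right_mono mult_mono) auto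
    also have "\<dots> = norm (T ** Y) / 2"
      using b(1) by (simp add: e_def divide_simps) (auto simp: add_nonneg_eq_0_iff)
    finally have "norm (A ** Y - T ** Y) \<le> norm (T ** Y) / 2" .
    moreover have "norm (T ** Y) \<le> norm (A ** Y) + norm (A ** Y - T ** Y)"
      by (metis norm_minus_commute norm_triangle_sub add.commute)
    ultimately show ?thesis by (simp add: T2)
  qed
  have "eventually (\<lambda>k. norm (X k - T) < e) sequentially"
    using X e by (simp add: tendsto_iff dist_norm)
  then obtain N where N: "\<And>k. k \<ge> N \<Longrightarrow> norm (X k - T) < e"
    by (auto simp: eventually_sequentially)
  \<comment> \<open>The domination holds only from index \<open>N\<close> on, hence the
    shift.\<close>
  have "(\<lambda>k. gaussian_integral f (X (k + N))) \<longlonglongrightarrow> gaussian_integral f T"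
    unfolding gaussian_integral_def
  proof (rule integral_dominated_convergence[OF _ _ int])
    have "(\<lambda>k. f Y * exp (- (norm (X (k + N) ** Y))\<^sup>2 / 2)) \<longlonglongrightarrow> f Y * exp (- (norm (T ** Y))\<^sup>2 / 2)"
      for Y
      by (intro tendsto_intros bounded_bilinear.tendsto[OF bounded_bilinear_matrix_mult]
          LIMSEQ_ignore_initial_segment X) auto
    thus "AE Y in lborel. (\<lambda>k. f Y * exp (- (norm (X (k + N) ** Y))\<^sup>2 / 2))
        \<longlonglongrightarrow> f Y * exp (- (norm (T ** Y))\<^sup>2 / 2)" by simp
    have "norm (f Y * exp (- (norm (X (k + N) ** Y))\<^sup>2 / 2)) \<le> M * exp (- (norm (T2 ** Y))\<^sup>2 / 2)" for k Y
    proof -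
      have "norm (T2 ** Y) \<le> norm (X (k + N) ** Y)" using half N by simp
      hence "(norm (T2 ** Y))\<^sup>2 \<le> (norm (X (k + N) ** Y))\<^sup>2" by (simp add: power_mono)
      thus ?thesis using bound[of Y] M by (auto simp: abs_mult intro!: mult_mono)
    qed
    thus "AE Y in lborel. norm (f Y * exp (- (norm (X (k + N) ** Y))\<^sup>2 / 2))
        \<le> M * exp (- (norm (T2 ** Y))\<^sup>2 / 2)" for k by simp
  qed measurable
  thus ?thesis by (rule LIMSEQ_offset)
qed

text \<open>The expectation at \<open>S\<close> is a quotient of two Gaussian integrals at the
  inverse of \<open>S\<close>, both continuous there. A set of full Lebesgue measure is dense, so
  the value \<open>a\<close> passes to every invertible \<open>S\<close> in the limit.\<close>

lemma integral_std_matrix_normal_eqI_AE: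
  fixes f :: "real^'p^'n \<Rightarrow> real"
  assumes f[measurable]: "f \<in> borel_measurable borel" and bound: "\<And>Y. \<bar>f Y\<bar> \<le> M"
    and AE: "AE S :: real^'n^'n in lborel. (\<integral>Z. f (S ** Z) \<partial>std_matrix_normal) = a"
    and S: "invertible (S :: real^'n^'n)"
  shows "(\<integral>Z. f (S ** Z) \<partial>std_matrix_normal) = a"
proof -
  interpret prob_space "std_matrix_normal :: (real^'p^'n) measure"
    by (rule prob_space_std_matrix_normal)
  let ?g = "\<lambda>f T :: real^'n^'n. gaussian_integral (f :: real^'p^'n \<Rightarrow> real) T"
  \<comment> \<open>The function 1 has expectation 1, which identifies the unknown factor as the
    reciprocal of its Gaussian integral.\<close>
  have ratio: "?g (\<lambda>_. 1) (matrix_inv G) > 0 \<and>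
      (\<integral>Z. f (G ** Z) \<partial>std_matrix_normal) * ?g (\<lambda>_. 1) (matrix_inv G) = ?g f (matrix_inv G)"
    if "invertible G" for G :: "real^'n^'n"
  proof -
    obtain k where k: "0 < k" "\<And>f :: real^'p^'n \<Rightarrow> real. f \<in> borel_measurable borel \<Longrightarrow>
      (\<integral>Z. f (G ** Z) \<partial>std_matrix_normal) = k * ?g f (matrix_inv G)"
      using integral_std_matrix_normal_mult[OF \<open>invertible G\<close>] by metis
    have "1 = k * ?g (\<lambda>_. 1) (matrix_inv G)"
      using k(2)[of "\<lambda>_. 1"] prob_space by simp
    moreover from this have "?g (\<lambda>_. 1) (matrix_inv G) > 0"
      using k(1) by (metis zero_less_mult_pos zero_less_one)
    ultimately show ?thesis using k(2)[OF f] by (simp add: mult_ac)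
  qed
  let ?P = "\<lambda>G :: real^'n^'n. det G \<noteq> 0 \<and> (\<integral>Z. f (G ** Z) \<partial>std_matrix_normal) = a"
  have "AE G in lborel. ?P G"
    using AE AE_lborel_det by eventually_elim simp
  from AE_E[OF this] obtain N where N': "{G \<in> space lborel. \<not> ?P G} \<subseteq> N"
      "emeasure lborel N = 0" "N \<in> sets lborel"
    by blast
  have N: "{G. \<not> ?P G} \<subseteq> N" "N \<in> null_sets lborel"
    using N'(1) null_setsI[OF N'(2,3)] by (simp_all only: space_lborel space_borel UNIV_I simp_thms)
  \<comment> \<open>The complement of the closure is open and contained in a null set, hence
    empty.\<close>
  have "closure {G. ?P G} = UNIV"
  proof (rule ccontr)
    assume "closure {G. ?P G} \<noteq> UNIV"
    hence "\<not> negligible (- closure {G. ?P G})"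
      by (intro open_not_negligible) auto
    moreover have "- closure {G. ?P G} \<subseteq> N"
      using N(1) closure_subset[of "{G. ?P G}"] by blast
    moreover have "negligible N"
      using N(2) by (simp add: negligible_iff_null_sets null_sets_completionI)
    ultimately show False using negligible_subset by blast
  qed
  hence "S \<in> closure {G. ?P G}" by simp
  then obtain G where G: "\<And>k. G k \<in> {G. ?P G}" "G \<longlonglongrightarrow> S"
    unfolding closure_sequential by blast
  have GT: "(\<lambda>k. matrix_inv (G k)) \<longlonglongrightarrow> matrix_inv S"
    by (rule continuous_on_tendsto_compose[OF continuous_on_matrix_inv G(2)])
      (use S G(1) in \<open>auto simp: invertible_det_nz\<close>)
  note lim = tendsto_gaussian_integral[OF _ _ invertible_matrix_inv(1)[OF S] GT]
  have "a * ?g (\<lambda>_. 1) (matrix_inv (G k)) = ?g f (matrix_inv (G k))" for k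
    using ratio[of "G k"] G(1)[of k] by (simp add: invertible_det_nz)
  moreover have "(\<lambda>k. ?g f (matrix_inv (G k))) \<longlonglongrightarrow> ?g f (matrix_inv S)"
    by (rule lim[OF f bound])
  moreover have "(\<lambda>k. a * ?g (\<lambda>_. 1) (matrix_inv (G k))) \<longlonglongrightarrow> a * ?g (\<lambda>_. 1) (matrix_inv S)"
    by (intro tendsto_intros lim[where M = 1]) auto
  ultimately have "a * ?g (\<lambda>_. 1) (matrix_inv S) = ?g f (matrix_inv S)"
    using LIMSEQ_unique by simp
  hence "(\<integral>Z. f (S ** Z) \<partial>std_matrix_normal) * ?g (\<lambda>_. 1) (matrix_inv S)
      = a * ?g (\<lambda>_. 1) (matrix_inv S)"
    using ratio[OF S] by simp
  thus ?thesis using ratio[OF S] by auto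
qed

section \<open>Normal expectations under rotation and selection\<close>

lemma integral_std_matrix_normal_orthogonal:
  fixes f :: "real^'p^'n \<Rightarrow> real" and g :: "real^'p^'n \<Rightarrow> real^'p^'n"
  assumes [measurable]: "f \<in> borel_measurable borel" and g: "orthogonal_transformation g"
  shows "(\<integral>Z. f (g Z) \<partial>std_matrix_normal) = (\<integral>Z. f Z \<partial>std_matrix_normal)"
proof -
  have [measurable]: "g \<in> borel_measurable borel"
    using g by (intro borel_measurable_continuous_onI linear_continuous_on)
      (simp add: orthogonal_transformation linear_conv_bounded_linear)
  have "(\<integral>Z. f Z \<partial>std_matrix_normal) = (\<integral>Z. f Z \<partial>distr std_matrix_normal borel g)"
    by (simp add: distr_std_matrix_normal_orthogonal[OF g])
  also have "\<dots> = (\<integral>Z. f (g Z) \<partial>std_matrix_normal)"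
    by (rule integral_distr) simp_all
  finally show ?thesis ..
qed

text \<open>Lets a normal matrix be realised as some of the columns of another one, in the
  application a square and almost surely invertible one.\<close>

lemma integral_std_matrix_normal_selection:
  fixes f :: "real^'p^'n \<Rightarrow> real"
  assumes [measurable]: "f \<in> borel_measurable borel" and h: "inj h"
  shows "(\<integral>Z. f ((Z :: real^'m^'n) ** selection_matrix h) \<partial>std_matrix_normal)
    = (\<integral>Z. f Z \<partial>std_matrix_normal)"
proof -
  have "distr (std_matrix_normal :: (real^'m^'n) measure) borel (\<lambda>Z. Z ** selection_matrix h)
      = (std_matrix_normal :: (real^'p^'n) measure)"
    using distr_std_matrix_normal_submatrix[of id h] h by (simp add: mult_selection_matrix)
  thus ?thesis
    using integral_distr[of "\<lambda>Z :: real^'m^'n. Z ** selection_matrix h" std_matrix_normal borel f]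
    by simp
qed

lemma integral_std_matrix_normal_row_selection:
  fixes f :: "real^'p^'n \<Rightarrow> real"
  assumes [measurable]: "f \<in> borel_measurable borel" and h: "inj h"
  shows "(\<integral>Z. f (transpose (selection_matrix h) ** (Z :: real^'p^'m)) \<partial>std_matrix_normal)
    = (\<integral>Z. f Z \<partial>std_matrix_normal)"
proof -
  have "distr (std_matrix_normal :: (real^'p^'m) measure) borel (\<lambda>Z. transpose (selection_matrix h) ** Z)
      = (std_matrix_normal :: (real^'p^'n) measure)"
    using distr_std_matrix_normal_submatrix[of h id] h by (simp add: transpose_selection_matrix_mult)
  thus ?thesis
    using integral_distr[of "\<lambda>Z :: real^'p^'m. transpose (selection_matrix h) ** Z"
      std_matrix_normal borel f]
    by simp
qed

section \<open>Constancy of the power\<close>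

text \<open>\<open>Z\<close> is realised as \<open>transpose J ** W\<close> with \<open>W\<close>
  square. As \<open>W\<close> is almost surely invertible, invariance removes it, and the power at
  \<open>R\<close> is the single value \<open>\<phi> (R ** transpose J)\<close>. Moving
  \<open>S\<close> to the right of \<open>transpose J\<close> makes it an invertible column
  transformation as well.\<close>

lemma constant_power_wide:
  fixes \<phi> :: "real^'p^'n \<Rightarrow> real"
  assumes \<phi>[measurable]: "\<phi> \<in> borel_measurable borel"
    and inv: "\<And>A Y. invertible A \<Longrightarrow> \<phi> (Y ** A) = \<phi> Y"
    and S: "invertible (S :: real^'n^'n)" and le: "CARD('n) \<le> CARD('p)"
  shows "(\<integral>Z. \<phi> (S ** Z) \<partial>std_matrix_normal) = (\<integral>Z. \<phi> Z \<partial>std_matrix_normal)"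
proof -
  interpret prob_space "std_matrix_normal :: (real^'p^'p) measure"
    by (rule prob_space_std_matrix_normal)
  obtain h :: "'n \<Rightarrow> 'p" where h: "inj h"
    using le inj_on_iff_card_le[of "UNIV :: 'n set" "UNIV :: 'p set"] by auto
  define J :: "real^'n^'p" where "J = selection_matrix h"
  have J: "transpose J ** J = mat 1"
    unfolding J_def by (rule selection_matrix_orthonormal[OF h])
  have power: "(\<integral>Z. \<phi> (R ** Z) \<partial>std_matrix_normal) = \<phi> (R ** transpose J)" for R :: "real^'n^'n"
  proof -
    have "(\<integral>Z. \<phi> (R ** Z) \<partial>std_matrix_normal)
        = (\<integral>W. \<phi> (R ** (transpose J ** (W :: real^'p^'p))) \<partial>std_matrix_normal)"
      unfolding J_def by (rule integral_std_matrix_normal_row_selection[symmetric, OF _ h]) measurable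
    also have "\<dots> = (\<integral>W. \<phi> (R ** transpose J) \<partial>(std_matrix_normal :: (real^'p^'p) measure))"
    proof (rule integral_cong_AE)
      show "AE W in (std_matrix_normal :: (real^'p^'p) measure).
          \<phi> (R ** (transpose J ** W)) = \<phi> (R ** transpose J)"
        using AE_std_matrix_normal[OF AE_lborel_det]
        by eventually_elim (simp add: inv matrix_mul_assoc invertible_det_nz)
    qed measurable
    also have "\<dots> = \<phi> (R ** transpose J)" using prob_space by simp
    finally show ?thesis .
  qed
  note zero = bounded_bilinear.zero_left[OF bounded_bilinear_matrix_mult]
  \<comment> \<open>The orthogonal projection onto the complement of the range of
    \<open>J\<close>.\<close>
  define P where "P = mat 1 - J ** transpose J"
  have JP: "transpose J ** P = 0" "P ** J = 0"
    unfolding P_def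
    by (simp_all add: bounded_bilinear.diff_left[OF bounded_bilinear_matrix_mult]
        bounded_bilinear.diff_right[OF bounded_bilinear_matrix_mult] matrix_mul_assoc J)
      (simp add: J flip: matrix_mul_assoc)
  \<comment> \<open>\<open>E R\<close> acts as \<open>R\<close> on the range of \<open>J\<close> and
    as the identity on its complement, so \<open>E (matrix_inv S)\<close> inverts
    \<open>E S\<close>.\<close>
  define E where "E R = J ** R ** transpose J + P" for R
  have E: "transpose J ** E R = R ** transpose J" for R
    by (simp add: E_def matrix_add_ldistrib matrix_mul_assoc J JP)
  have "E S ** E (matrix_inv S) = mat 1"
  proof -
    have "E S ** E (matrix_inv S) = J ** S ** (transpose J ** E (matrix_inv S)) + P ** E (matrix_inv S)"
      by (simp add: E_def[of S] bounded_bilinear.add_left[OF bounded_bilinear_matrix_mult] matrix_mul_assoc)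
    also have "J ** S ** (transpose J ** E (matrix_inv S)) = J ** (S ** matrix_inv S) ** transpose J"
      by (simp only: E matrix_mul_assoc)
    also have "\<dots> = J ** transpose J"
      by (simp add: matrix_inv_inverse[OF S])
    also have "P ** E (matrix_inv S) = P ** P"
      by (simp add: E_def matrix_add_ldistrib matrix_mul_assoc JP zero)
    also have "\<dots> = P ** (mat 1 - J ** transpose J)"
      by (simp add: P_def)
    also have "\<dots> = P"
      by (simp add: bounded_bilinear.diff_right[OF bounded_bilinear_matrix_mult] matrix_mul_assoc JP zero)
    finally show ?thesis by (simp add: P_def)
  qed
  hence "invertible (E S)" by (auto simp: invertible_right_inverse)
  hence "\<phi> (S ** transpose J) = \<phi> (transpose J)"
    using inv[of "E S" "transpose J"] by (simp add: E)
  thus ?thesis using power[of S] power[of "mat 1"] by simp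
qed

text \<open>For a fixed invertible \<open>W\<close>, the Gaussian matrix \<open>G ** W ** J\<close> has the null distribution
  up to a column transformation; for a fixed invertible \<open>G\<close>, it has the law of \<open>G ** Z\<close>. Hence the
  power at \<open>G\<close> averages to the level over \<open>G\<close>.\<close>

lemma constant_power_tall:
  fixes \<phi> :: "real^'p^'n \<Rightarrow> real"
  assumes \<phi>[measurable]: "\<phi> \<in> borel_measurable borel" and bound: "\<And>Y. 0 \<le> \<phi> Y \<and> \<phi> Y \<le> 1"
    and inv: "\<And>A Y. invertible A \<Longrightarrow> \<phi> (Y ** A) = \<phi> Y"
    and unbiased: "\<And>S :: real^'n^'n. invertible S \<Longrightarrow>
      (\<integral>Z. \<phi> Z \<partial>std_matrix_normal) \<le> (\<integral>Z. \<phi> (S ** Z) \<partial>std_matrix_normal)"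
    and S: "invertible (S :: real^'n^'n)" and le: "CARD('p) \<le> CARD('n)"
  shows "(\<integral>Z. \<phi> (S ** Z) \<partial>std_matrix_normal) = (\<integral>Z. \<phi> Z \<partial>std_matrix_normal)"
proof -
  let ?N = "std_matrix_normal :: (real^'n^'n) measure"
  interpret N: prob_space ?N
    by (rule prob_space_std_matrix_normal)
  interpret NN: pair_prob_space ?N ?N ..
  define \<alpha> where "\<alpha> = (\<integral>Z. \<phi> Z \<partial>std_matrix_normal)"
  define \<beta> where "\<beta> G = (\<integral>Z. \<phi> (G ** Z) \<partial>std_matrix_normal)" for G :: "real^'n^'n"
  obtain h :: "'p \<Rightarrow> 'n" where h: "inj h"
    using le inj_on_iff_card_le[of "UNIV :: 'p set" "UNIV :: 'n set"] by auto
  define J :: "real^'p^'n" where "J = selection_matrix h"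
  have J: "transpose J ** J = mat 1"
    unfolding J_def by (rule selection_matrix_orthonormal[OF h])
  \<comment> \<open>With \<open>W\<close> square, \<open>G\<close> and \<open>W\<close> have the
    same law and can be treated as an independent pair.\<close>
  have \<beta>: "\<beta> G = (\<integral>W. \<phi> (G ** (W ** J)) \<partial>?N)" for G
    unfolding J_def \<beta>_def by (rule integral_std_matrix_normal_selection[symmetric, OF _ h]) measurable
  have null: "(\<integral>G. \<phi> (G ** (W ** J)) \<partial>?N) = \<alpha>" if W: "det W \<noteq> 0" for W
  proof -
    have "x = 0" if "(W ** J) *v x = 0" for x
    proof -
      have "W *v (J *v x) = 0" using that by (simp add: matrix_vector_mul_assoc)
      hence "J *v x = 0"
        using W by (metis invertible_det_nz invertible_left_inverse matrix_left_invertible_ker)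
      hence "(transpose J ** J) *v x = 0" by (simp flip: matrix_vector_mul_assoc)
      thus ?thesis by (simp add: J)
    qed
    then obtain Q A where QA: "orthogonal_matrix Q" "invertible A" "W ** J = Q ** J ** A"
      using matrix_factor_orthogonal[OF _ J] by metis
    \<comment> \<open>Invariance of \<open>\<phi>\<close> absorbs \<open>A\<close>; next, rotation
      invariance of the law of \<open>G\<close> absorbs \<open>Q\<close>.\<close>
    have "(\<integral>G. \<phi> (G ** (W ** J)) \<partial>?N) = (\<integral>G. \<phi> ((G ** Q) ** J) \<partial>?N)"
      using inv[OF QA(2)] by (simp add: QA(3) matrix_mul_assoc)
    also have "\<dots> = (\<integral>G. \<phi> (G ** J) \<partial>?N)"
      by (rule integral_std_matrix_normal_orthogonal[OF _ orthogonal_transformation_matrix_mult_right[OF QA(1)]])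
        measurable
    also have "\<dots> = \<alpha>"
      unfolding J_def \<alpha>_def by (rule integral_std_matrix_normal_selection[OF \<phi> h])
    finally show ?thesis .
  qed
  have \<beta>m[measurable]: "\<beta> \<in> borel_measurable ?N"
    unfolding \<beta> by (rule N.borel_measurable_lebesgue_integral) measurable
  have \<beta>b: "norm (\<beta> G) \<le> 1" for G
  proof -
    have "(\<integral>W. \<phi> (G ** (W ** J)) \<partial>?N) \<le> (\<integral>W. 1 \<partial>?N)"
      using bound by (intro integral_mono N.integrable_const_bound[of _ 1]) auto
    moreover have "0 \<le> \<beta> G" unfolding \<beta> using bound by (intro integral_nonneg_AE) auto
    ultimately show ?thesis using N.prob_space by (simp add: \<beta>)
  qed
  have int: "integrable (?N \<Otimes>\<^sub>M ?N) (\<lambda>(G, W). \<phi> (G ** (W ** J)))"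
    using bound by (intro NN.integrable_const_bound[of _ 1]) (auto simp: split_beta)
  \<comment> \<open>Integrating over \<open>W\<close> first gives \<open>\<beta>\<close>;
    integrating over \<open>G\<close> first gives \<open>\<alpha>\<close> for almost every
    \<open>W\<close>.\<close>
  have "(\<integral>G. \<beta> G \<partial>?N) = (\<integral>W. (\<integral>G. \<phi> (G ** (W ** J)) \<partial>?N) \<partial>?N)"
    unfolding \<beta> by (rule NN.Fubini_integral[OF int, symmetric])
  also have "\<dots> = (\<integral>W. \<alpha> \<partial>?N)"
  proof (rule integral_cong_AE)
    show "AE W in ?N. (\<integral>G. \<phi> (G ** (W ** J)) \<partial>?N) = \<alpha>"
      using AE_std_matrix_normal[OF AE_lborel_det] by eventually_elim (rule null)
    show "(\<lambda>W. \<integral>G. \<phi> (G ** (W ** J)) \<partial>?N) \<in> borel_measurable ?N"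
      by (rule N.borel_measurable_lebesgue_integral) measurable
  qed simp
  finally have "(\<integral>G. \<beta> G \<partial>?N) = \<alpha>" using N.prob_space by simp
  moreover have int\<beta>: "integrable ?N \<beta>"
    by (rule N.integrable_const_bound[of _ 1]) (auto simp: \<beta>b[simplified])
  ultimately have "(\<integral>G. \<beta> G - \<alpha> \<partial>?N) = 0"
    using N.prob_space by simp
  \<comment> \<open>Unbiasedness makes the difference nonnegative at every invertible
    \<open>G\<close>; having integral 0, it vanishes almost surely.\<close>
  moreover have "AE G in ?N. 0 \<le> \<beta> G - \<alpha>"
    using AE_std_matrix_normal[OF AE_lborel_det]
    by eventually_elim (use unbiased in \<open>simp add: \<beta>_def \<alpha>_def invertible_det_nz\<close>)
  ultimately have "AE G in ?N. \<beta> G - \<alpha> = 0"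
    using integral_nonneg_eq_0_iff_AE[of ?N "\<lambda>G. \<beta> G - \<alpha>"] int\<beta> by simp
  hence "AE G in lborel. \<beta> G = \<alpha>"
    using AE_lborel_std_matrix_normal by auto
  moreover have "\<bar>\<phi> Y\<bar> \<le> 1" for Y using bound[of Y] by simp
  ultimately show ?thesis
    unfolding \<beta>_def \<alpha>_def using integral_std_matrix_normal_eqI_AE[OF \<phi> _ _ S] by blast
qed

section \<open>Return to the model with symmetric square roots\<close>

text \<open>Polar decomposition \<open>G = R ** Q\<close>, with \<open>R\<close> the symmetric root
  and \<open>Q\<close> orthogonal; \<open>Q\<close> is absorbed by the law of \<open>Z\<close>. This
  carries unbiasedness from symmetric roots to arbitrary invertible matrices, such as almost every
  Gaussian \<open>G\<close>.\<close>

lemma integral_sym_sqrt_gram: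
  fixes f :: "real^'p^'n \<Rightarrow> real"
  assumes [measurable]: "f \<in> borel_measurable borel" and G: "invertible (G :: real^'n^'n)"
  shows "(\<integral>Z. f (G ** Z) \<partial>std_matrix_normal)
    = (\<integral>Z. f (sym_sqrt (G ** transpose G) ** Z) \<partial>std_matrix_normal)"
proof -
  define R where "R = sym_sqrt (G ** transpose G)"
  note spd = gram_sym_pos_def[OF G]
  have R: "R \<in> sym_pos_def" "R ** R = G ** transpose G"
    unfolding R_def using sym_sqrt_sym_pos_def[OF spd] sym_sqrt_square[OF spd] by auto
  have sym: "transpose R = R" and inv: "invertible R"
    using R(1) invertible_sym_pos_def by (auto simp: sym_pos_def_def)
  note Ri = matrix_inv_inverse[OF inv]
  define Q where "Q = matrix_inv R ** G"
  have RQ: "R ** Q = G" by (simp add: Q_def matrix_mul_assoc Ri)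
  have "transpose (matrix_inv R) = matrix_inv R"
  proof -
    have "R ** transpose (matrix_inv R) = mat 1"
      using arg_cong[OF Ri(2), of transpose] by (simp add: matrix_transpose_mul sym)
    hence "matrix_inv R ** (R ** transpose (matrix_inv R)) = matrix_inv R" by simp
    thus ?thesis by (simp add: matrix_mul_assoc Ri)
  qed
  hence "Q ** transpose Q = matrix_inv R ** (G ** transpose G) ** matrix_inv R"
    by (simp add: Q_def matrix_transpose_mul matrix_mul_assoc)
  also have "\<dots> = (matrix_inv R ** R) ** (R ** matrix_inv R)"
    by (simp add: R(2)[symmetric] matrix_mul_assoc)
  finally have "orthogonal_matrix Q"
    by (simp add: Ri orthogonal_matrix_def matrix_left_right_inverse)
  hence "(\<integral>Z. f (R ** (Q ** Z)) \<partial>std_matrix_normal) = (\<integral>Z. f (R ** Z) \<partial>std_matrix_normal)"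
    by (intro integral_std_matrix_normal_orthogonal orthogonal_transformation_matrix_mult_left) measurable
  thus ?thesis by (simp add: matrix_mul_assoc RQ flip: R_def)
qed

theorem corollary2:
  fixes X :: "real ^ 'q ^ 'n"
    and \<phi> :: "real ^ 'p ^ 'n \<Rightarrow> real"
    and \<alpha> :: real
    and B :: "real ^ 'q ^ 'p"
    and \<Sigma> :: "real ^ 'p ^ 'p"
  assumes "rank X = CARD('q)" and "CARD('q) < CARD('n)"
    and "is_test \<phi>"
    and "invariant_test (transf_group X) \<phi>"
    and "level_test X \<alpha> \<phi>"
    and "\<Sigma> \<in> sym_pos_def"
    and "\<forall>\<Psi>\<in>sym_pos_def. model_expectation X B \<Sigma> \<Psi> \<phi> \<ge> \<alpha>"
  shows "\<forall>\<Psi>\<in>sym_pos_def. model_expectation X B \<Sigma> \<Psi> \<phi> = \<alpha>"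
proof -
  have \<phi>[measurable]: "\<phi> \<in> borel_measurable borel" and bound: "\<And>Y. 0 \<le> \<phi> Y \<and> \<phi> Y \<le> 1"
    using \<open>is_test \<phi>\<close> by (auto simp: is_test_def)
  have inv: "\<phi> (X ** transpose C + Y ** transpose A) = \<phi> Y"
    if "invertible A" for A Y and C :: "real^'q^'p"
  proof -
    have "(\<lambda>Y. X ** transpose C + Y ** transpose A) \<in> transf_group X"
      unfolding transf_group_def using that by blast
    thus ?thesis
      using \<open>invariant_test (transf_group X) \<phi>\<close> by (auto simp: invariant_test_def dest: bspec)
  qed
  have inv': "\<phi> (Y ** A) = \<phi> Y" if "invertible A" for A Y
    using inv[of "transpose A" 0 Y] transpose_invertible[OF that]
    by (simp add: transpose_def matrix_matrix_mult_def flip: zero_vec_def)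
  \<comment> \<open>The group element with \<open>C = B\<close> and \<open>A\<close> the symmetric
    root of \<open>\<Sigma>\<close> removes the mean and the column covariance.\<close>
  have model: "model_expectation X B \<Sigma> \<Psi> \<phi> = (\<integral>Z. \<phi> (sym_sqrt \<Psi> ** Z) \<partial>std_matrix_normal)" for \<Psi>
  proof -
    let ?R = "sym_sqrt \<Sigma>"
    have R: "invertible ?R" "transpose ?R = ?R"
      using sym_sqrt_sym_pos_def[OF \<open>\<Sigma> \<in> sym_pos_def\<close>] invertible_sym_pos_def
      by (auto simp: sym_pos_def_def)
    have "model_expectation X B \<Sigma> \<Psi> \<phi>
        = (\<integral>Z. \<phi> (X ** transpose B + sym_sqrt \<Psi> ** Z ** ?R) \<partial>std_matrix_normal)"
      unfolding model_expectation_def matrix_normal_def by (rule integral_distr) measurable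
    thus ?thesis using inv[OF R(1)] by (simp add: R(2))
  qed
  have level: "(\<integral>Z. \<phi> Z \<partial>std_matrix_normal) = \<alpha>"
    using \<open>level_test X \<alpha> \<phi>\<close> \<open>\<Sigma> \<in> sym_pos_def\<close> model[of "mat 1"]
    by (simp add: level_test_def sym_sqrt_mat_1)
  \<comment> \<open>The hypothesis on the power is used at
    \<open>\<Psi> = S ** transpose S\<close>.\<close>
  have unbiased: "(\<integral>Z. \<phi> Z \<partial>std_matrix_normal) \<le> (\<integral>Z. \<phi> (S ** Z) \<partial>std_matrix_normal)"
    if "invertible S" for S :: "real^'n^'n"
    using assms(7) gram_sym_pos_def[OF that]
    by (simp add: level integral_sym_sqrt_gram[OF \<phi> that] flip: model)
  have "(\<integral>Z. \<phi> (S ** Z) \<partial>std_matrix_normal) = (\<integral>Z. \<phi> Z \<partial>std_matrix_normal)"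
    if "invertible S" for S :: "real^'n^'n"
  proof (cases "CARD('n) \<le> CARD('p)")
    case True
    thus ?thesis using constant_power_wide[OF \<phi> inv' that] by blast
  next
    case False
    thus ?thesis using constant_power_tall[OF \<phi> bound inv' unbiased that] by simp
  qed
  hence "model_expectation X B \<Sigma> \<Psi> \<phi> = \<alpha>" if "\<Psi> \<in> sym_pos_def" for \<Psi>
    using invertible_sym_pos_def[OF sym_sqrt_sym_pos_def[OF that]] by (simp add: model level)
  thus ?thesis by blast
qed

end
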